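(* Let $n\ge2$ and let $\mathcal{A}(t,x)=(A_0(t,x),\dots,A_n(t,x))$ be $C^\infty$ in $(t,x)\in\mathbb{R}\times\mathbb{R}^n$. Suppose that for any non-negative integer $\alpha$, any multi-index $\beta$ and any $0\le j\le n$ there exist positive constants $c$, $C_{\alpha,\beta}$ such that for $|t|\ge t_0$, $$|\partial_t^\alpha\partial_x^\beta A_j(t,x)|\le C_{\alpha,\beta}e^{-c|t|}.$$ Suppose in addition that $A_j(t,x)=0$ for $|x|\ge R>0$, $0\le j\le n$, and that $$\int_{-\infty}^{\infty}\Big(A_0+\sum_{j=1}^n\omega_jA_j\Big)(t+s,x+s\omega)\,ds=0\qquad\text{for all }(t,x)\in\mathbb{R}\times\mathbb{R}^n,\ \omega\in S^{n-1}.$$ Then there exist $\varphi\in C^\infty(\mathbb{R}\times\mathbb{R}^n)$ and positive constants $C'_{\alpha,\beta}$, $c'$ such that (i) $A_0=\partial_t\varphi$ and $A_j=\partial_{x_j}\varphi$ for $1\le j\le n$; (ii) $\operatorname{supp}\varphi\subseteq\mathbb{R}\times\{|x|\le R\}$ and $|\partial_t^\alpha\partial_x^\beta\varphi(t,x)|\le C'_{\alpha,\beta}e^{-c'|t|}$ for all $\alpha,\beta$.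
   Context: Functions are complex-valued. $S^{n-1}$ is the unit sphere of $\mathbb{R}^n$. $t_0>0$ and $R>0$ are fixed numbers. *)

theory Defs
  imports "HOL-Analysis.Analysis"
begin

text \<open>Iterated continuous Frechet differentiability on the whole space; in finite dimension it
  suffices to control the derivative in every fixed direction.\<close>

primrec Ck :: "nat \<Rightarrow> ('a::euclidean_space \<Rightarrow> 'b::real_normed_vector) \<Rightarrow> bool" where
  "Ck 0 f \<longleftrightarrow> continuous_on UNIV f"
| "Ck (Suc k) f \<longleftrightarrow>
     (\<forall>p. f differentiable (at p)) \<and> (\<forall>v. Ck k (\<lambda>p. frechet_derivative f (at p) v))"

definition smooth :: "('a::euclidean_space \<Rightarrow> 'b::real_normed_vector) \<Rightarrow> bool" where
  "smooth f \<longleftrightarrow> (\<forall>k. Ck k f)"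

definition dt :: "(real \<times> (real ^ 'n) \<Rightarrow> complex) \<Rightarrow> real \<times> (real ^ 'n) \<Rightarrow> complex" where
  "dt f = (\<lambda>(t, x). vector_derivative (\<lambda>s. f (s, x)) (at t))"

definition dx :: "'n \<Rightarrow> (real \<times> (real ^ 'n) \<Rightarrow> complex) \<Rightarrow> real \<times> (real ^ 'n) \<Rightarrow> complex" where
  "dx j f = (\<lambda>(t, x). vector_derivative (\<lambda>s. f (t, x + s *\<^sub>R axis j 1)) (at 0))"

text \<open>The spatial partial derivatives are composed along an arbitrary enumeration of the
  coordinates; they commute on smooth functions, so there the choice is immaterial.\<close>

definition coords :: "'n::finite list" where
  "coords = (SOME js. distinct js \<and> set js = UNIV)"

definition dx_multi ::
    "('n::finite \<Rightarrow> nat) \<Rightarrow> (real \<times> (real ^ 'n) \<Rightarrow> complex) \<Rightarrow> real \<times> (real ^ 'n) \<Rightarrow> complex" where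
  "dx_multi \<beta> = foldr (\<lambda>j. dx j ^^ \<beta> j) coords"

end

theory Submission
  imports Defs "HOL-Probability.Levy" "HOL-Complex_Analysis.Complex_Analysis"
begin

text \<open>Write \<open>\<alpha>\<close> for the 1-form \<open>A\<^sub>0 dt + \<Sum>\<^sub>j A\<^sub>j
dx\<^sub>j\<close> on space-time. The claim is that \<open>\<alpha>\<close> is exact, with a potential that is
as well localised as \<open>\<alpha>\<close> itself. The proof shows that \<open>\<alpha>\<close> is closed
and then integrates it.

Closedness is a Fourier argument. If \<open>\<zeta> = (\<tau>, \<xi>)\<close> annihilates a light direction
\<open>(1, \<omega>)\<close>, then the character with frequency \<open>\<zeta>\<close> is constant along the
light rays in that direction, so integrating the hypothesis over the rays shows that the Fourier transform of
\<open>\<alpha>(1, \<omega>)\<close> vanishes at \<open>\<zeta>\<close>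
(\<open>fourier_light_ray_slice\<close>). For spacelike \<open>\<zeta>\<close>, that is \<open>|\<tau>| <
|\<xi>|\<close>, the light directions orthogonal to \<open>\<zeta>\<close> span the whole hyperplane
orthogonal to \<open>\<zeta>\<close> (\<open>linear_form_eq_0_on_orthogonal\<close>; this is where dimension
at least 2 enters), hence the transform of \<open>\<alpha>\<close> at \<open>\<zeta>\<close> is proportional
to \<open>\<zeta>\<close> and the transform of the exterior derivative \<open>d\<alpha>\<close> vanishes
there. The spacelike cone is only an open set of frequencies, but \<open>\<alpha>\<close> decays exponentially
in time: for fixed \<open>\<xi>\<close> the transform extends holomorphically in \<open>\<tau>\<close> to a
strip, so it vanishes for all real \<open>\<tau>\<close>. Uniqueness of Fourier transforms, in time by Levy's
theorem and in space by approximating with trigonometric polynomials on a ball, gives \<open>d\<alpha> =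
0\<close> (\<open>eq_0_if_fourier_eq_0_spacelike\<close>, \<open>closed_if_light_ray_transform_eq_0\<close>).

The potential is the integral of \<open>\<alpha>\<close> along segments from a base point outside the support
(\<open>poincare_lemma\<close>). It is locally constant where \<open>\<alpha>\<close> vanishes, and the
exterior of the tube \<open>|x| \<le> R\<close> is connected, so it vanishes there; its decay follows by
integrating \<open>\<alpha>\<close> over a spatial segment that leaves the tube.

The hypotheses allow a different decay rate for every derivative, whereas one rate is claimed for all
derivatives of the potential. The gap is closed by interpolation: if a function decays at least as fast as its
second derivative, then its first derivative decays at least at the mean of the two rates, so the optimal
rates of successive derivatives, once they start to decrease, decrease at least linearly. Being nonnegative
they never do, and every derivative decays at any rate below that of the function
(\<open>exp_decay_interpolate\<close>, \<open>exp_decay_derivatives\<close>).\<close>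

section \<open>Smooth functions\<close>

lemma Ck_SucD: "Ck (Suc k) f \<Longrightarrow> Ck k f"
proof (induction k arbitrary: f)
  case 0
  then have "f differentiable (at p)" for p by simp
  then show ?case
    by (auto intro!: continuous_at_imp_continuous_on differentiable_imp_continuous_within)
next
  case (Suc k)
  then show ?case by (metis Ck.simps(2))
qed

lemma smooth_differentiable: "smooth f \<Longrightarrow> f differentiable (at p)"
  unfolding smooth_def by (metis Ck.simps(2))

lemma smooth_continuous: "smooth f \<Longrightarrow> continuous_on S f"
  unfolding smooth_def using Ck.simps(1) continuous_on_subset by blast

lemma smooth_has_derivative:
  "smooth f \<Longrightarrow> (f has_derivative frechet_derivative f (at p)) (at p)"
  using smooth_differentiable frechet_derivative_works by blast

lemma smooth_frechet_derivative: "smooth f \<Longrightarrow> smooth (\<lambda>p. frechet_derivative f (at p) v)"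
  unfolding smooth_def by (metis Ck.simps(2))

lemma smooth_if_derivative_smooth:
  assumes "\<And>p. (f has_derivative f' p) (at p)" and "\<And>v. smooth (\<lambda>p. f' p v)"
  shows "smooth f"
  unfolding smooth_def
proof
  fix k
  have "frechet_derivative f (at p) = f' p" for p
    using assms(1) frechet_derivative_at by metis
  then have "Ck (Suc k) f"
    using assms by (auto simp: smooth_def differentiable_def)
  then show "Ck k f" by (rule Ck_SucD)
qed

lemma Ck_add: "Ck k f \<Longrightarrow> Ck k g \<Longrightarrow> Ck k (\<lambda>p. f p + g p)"
proof (induction k arbitrary: f g)
  case 0
  then show ?case by (simp add: continuous_on_add)
next
  case (Suc k)
  have d: "((\<lambda>p. f p + g p) has_derivative
      (\<lambda>v. frechet_derivative f (at p) v + frechet_derivative g (at p) v)) (at p)" for p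
    using Suc.prems frechet_derivative_works by (intro has_derivative_add) auto
  then have "frechet_derivative (\<lambda>p. f p + g p) (at p)
      = (\<lambda>v. frechet_derivative f (at p) v + frechet_derivative g (at p) v)" for p
    using frechet_derivative_at by metis
  then show ?case using Suc differentiableI[OF d] by simp
qed

lemma Ck_bounded_linear:
  assumes "bounded_linear L"
  shows "Ck k f \<Longrightarrow> Ck k (\<lambda>p. L (f p))"
proof (induction k arbitrary: f)
  case 0
  then show ?case using assms by (simp add: bounded_linear.continuous_on)
next
  case (Suc k)
  have d: "((\<lambda>p. L (f p)) has_derivative (\<lambda>v. L (frechet_derivative f (at p) v))) (at p)" for p
    using Suc.prems frechet_derivative_works
    by (intro bounded_linear.has_derivative[OF assms]) auto
  then have "frechet_derivative (\<lambda>p. L (f p)) (at p) = (\<lambda>v. L (frechet_derivative f (at p) v))" for p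
    using frechet_derivative_at by metis
  then show ?case using Suc differentiableI[OF d] by simp
qed

lemma smooth_add: "smooth f \<Longrightarrow> smooth g \<Longrightarrow> smooth (\<lambda>p. f p + g p)"
  by (simp add: smooth_def Ck_add)

lemma smooth_bounded_linear: "bounded_linear L \<Longrightarrow> smooth f \<Longrightarrow> smooth (\<lambda>p. L (f p))"
  by (simp add: smooth_def Ck_bounded_linear)

lemma smooth_sum:
  fixes f :: "'i \<Rightarrow> 'a::euclidean_space \<Rightarrow> 'c::real_normed_vector"
  shows "finite I \<Longrightarrow> (\<And>i. i \<in> I \<Longrightarrow> smooth (f i)) \<Longrightarrow> smooth (\<lambda>p. \<Sum>i\<in>I. f i p)"
proof (induction I rule: finite_induct)
  case empty
  have "Ck k (\<lambda>p :: 'a. 0 :: 'c)" for k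
    by (induction k) auto
  then show ?case by (simp add: smooth_def)
next
  case (insert i I)
  then show ?case by (simp add: smooth_add)
qed

section \<open>Exponential decay in time and interpolation of rates\<close>

text \<open>The rate refers to the first component (time) and is uniform in the second; a rate of 0 is
boundedness.\<close>

definition exp_decay :: "real \<Rightarrow> (real \<times> 'a \<Rightarrow> 'b::real_normed_vector) \<Rightarrow> bool" where
  "exp_decay r h \<longleftrightarrow> (\<exists>C. \<forall>t x. norm (h (t, x)) \<le> C * exp (- r * \<bar>t\<bar>))"

lemma exp_decayD:
  assumes "exp_decay r h"
  shows "\<exists>C>0. \<forall>p. norm (h p) \<le> C * exp (- r * \<bar>fst p\<bar>)"
proof -
  from assms obtain C where C: "\<And>t x. norm (h (t, x)) \<le> C * exp (- r * \<bar>t\<bar>)"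
    unfolding exp_decay_def by blast
  have "norm (h p) \<le> (\<bar>C\<bar> + 1) * exp (- r * \<bar>fst p\<bar>)" for p
    by (cases p) (use C in \<open>auto intro!: order_trans[OF C] mult_right_mono\<close>)
  then show ?thesis by (intro exI[of _ "\<bar>C\<bar> + 1"]) auto
qed

lemma exp_decayI: "(\<And>p. norm (h p) \<le> C * exp (- r * \<bar>fst p\<bar>)) \<Longrightarrow> exp_decay r h"
  unfolding exp_decay_def by (metis fst_conv)

lemma exp_decay_mono: "exp_decay r h \<Longrightarrow> s \<le> r \<Longrightarrow> exp_decay s h"
proof -
  assume "exp_decay r h" and sr: "s \<le> r"
  then obtain C where C: "C > 0" "\<And>p. norm (h p) \<le> C * exp (- r * \<bar>fst p\<bar>)"
    by (auto dest: exp_decayD)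
  have "norm (h p) \<le> C * exp (- s * \<bar>fst p\<bar>)" for p
    by (rule order_trans[OF C(2)]) (use C(1) sr in \<open>auto intro!: mult_right_mono\<close>)
  then show ?thesis by (rule exp_decayI)
qed

lemma norm_diff_le_vector_derivative_bound:
  fixes f :: "real \<Rightarrow> 'a::real_normed_vector"
  assumes "\<And>s. s \<in> {0..\<epsilon>} \<Longrightarrow> (f has_vector_derivative f' s) (at s)"
    and "\<And>s. s \<in> {0..\<epsilon>} \<Longrightarrow> norm (f' s) \<le> B" and "s \<in> {0..\<epsilon>}"
  shows "norm (f s - f 0) \<le> B * s"
proof -
  have "norm (f s - f 0) \<le> B * norm (s - 0)"
  proof (rule differentiable_bound[of "{0..\<epsilon>}" f "\<lambda>s r. r *\<^sub>R f' s"])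
    fix x assume x: "x \<in> {0..\<epsilon>}"
    then show "(f has_derivative (\<lambda>r. r *\<^sub>R f' x)) (at x within {0..\<epsilon>})"
      using assms(1) by (auto simp: has_vector_derivative_def intro: has_derivative_at_withinI)
    show "onorm (\<lambda>r. r *\<^sub>R f' x) \<le> B"
      using assms(2)[OF x] by (intro onorm_le) (simp add: mult.commute[of B] mult_left_mono)
  qed (use assms in auto)
  then show ?thesis using assms by simp
qed

text \<open>A Landau inequality with exponential weights. Taylor's formula with step \<open>\<epsilon>\<close>
bounds the first derivative by a multiple of \<open>e^(- a |t|) / \<epsilon> + \<epsilon> e^(- b |t|)\<close>,
and \<open>\<epsilon> = e^(- (a - b) |t| / 2)\<close> balances both terms. Since \<open>\<epsilon> \<le>
1\<close> and \<open>v\<close> moves time at most at unit speed, the step changes \<open>|t|\<close> by at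
most 1, which costs only a constant factor.\<close>

lemma exp_decay_interpolate:
  fixes h :: "real \<times> 'a::real_normed_vector \<Rightarrow> 'b::real_normed_vector"
  assumes d1: "\<And>p. ((\<lambda>s. h (p + s *\<^sub>R v)) has_vector_derivative h' p) (at 0)"
    and d2: "\<And>p. ((\<lambda>s. h' (p + s *\<^sub>R v)) has_vector_derivative h'' p) (at 0)"
    and v: "\<bar>fst v\<bar> \<le> 1"
    and ab: "0 \<le> b" "b \<le> a" and "exp_decay a h" "exp_decay b h''"
  shows "exp_decay ((a + b) / 2) h'"
proof -
  obtain C where C: "C > 0" "\<And>p. norm (h p) \<le> C * exp (- a * \<bar>fst p\<bar>)"
    using \<open>exp_decay a h\<close> by (auto dest: exp_decayD)
  obtain B where B: "B > 0" "\<And>p. norm (h'' p) \<le> B * exp (- b * \<bar>fst p\<bar>)"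
    using \<open>exp_decay b h''\<close> by (auto dest: exp_decayD)
  have shift: "((\<lambda>s. g (p + s *\<^sub>R v)) has_vector_derivative g' (p + s *\<^sub>R v)) (at s)"
    if "\<And>p. ((\<lambda>s. g (p + s *\<^sub>R v)) has_vector_derivative g' p) (at 0)"
    for g g' :: "real \<times> 'a \<Rightarrow> 'b" and p s
    using that[of "p + s *\<^sub>R v"]
    by (simp add: has_vector_derivative_def has_derivative_at algebra_simps)
  have "norm (h' p) \<le> (C * exp a + C + B * exp b) * exp (- ((a + b) / 2) * \<bar>fst p\<bar>)" for p
  proof -
    define t where "t = \<bar>fst p\<bar>"
    define \<epsilon> where "\<epsilon> = exp (- ((a - b) / 2) * t)"
    have \<epsilon>: "0 < \<epsilon>" "\<epsilon> \<le> 1" unfolding \<epsilon>_def t_def using ab by auto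
    have near: "t - 1 \<le> \<bar>fst (p + s *\<^sub>R v)\<bar>" if "s \<in> {0..\<epsilon>}" for s
    proof -
      have "\<bar>s * fst v\<bar> \<le> 1 * 1"
        unfolding abs_mult using that \<epsilon> v by (intro mult_mono) auto
      then show ?thesis by (auto simp: t_def)
    qed
    define M where "M = B * exp b * exp (- b * t)"
    have M: "norm (h'' (p + s *\<^sub>R v)) \<le> M" if "s \<in> {0..\<epsilon>}" for s
    proof -
      have "b * (t - 1) \<le> b * \<bar>fst (p + s *\<^sub>R v)\<bar>"
        using near[OF that] ab by (intro mult_left_mono) auto
      then have "exp (- b * \<bar>fst (p + s *\<^sub>R v)\<bar>) \<le> exp b * exp (- b * t)"
        unfolding exp_add[symmetric] by (simp add: algebra_simps)
      then show ?thesis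
        unfolding M_def using B(1) by (intro order_trans[OF B(2)]) (simp add: mult.assoc)
    qed
    have d: "norm (h' (p + s *\<^sub>R v) - h' p) \<le> M * \<epsilon>" if "s \<in> {0..\<epsilon>}" for s
    proof -
      have "norm (h' (p + s *\<^sub>R v) - h' (p + 0 *\<^sub>R v)) \<le> M * s"
        by (rule norm_diff_le_vector_derivative_bound[OF shift[OF d2] M that])
      also have "\<dots> \<le> M * \<epsilon>"
        using that B(1) by (intro mult_left_mono) (auto simp: M_def)
      finally show ?thesis by simp
    qed
    have "norm ((h (p + \<epsilon> *\<^sub>R v) - \<epsilon> *\<^sub>R h' p) - (h (p + 0 *\<^sub>R v) - 0 *\<^sub>R h' p)) \<le> M * \<epsilon> * \<epsilon>"
    proof (rule norm_diff_le_vector_derivative_bound[where \<epsilon> = \<epsilon>, OF _ d])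
      show "((\<lambda>s. h (p + s *\<^sub>R v) - s *\<^sub>R h' p) has_vector_derivative h' (p + s *\<^sub>R v) - h' p) (at s)" for s
        by (auto intro!: derivative_eq_intros shift[OF d1])
    qed (use \<epsilon> in auto)
    then have *: "norm (h (p + \<epsilon> *\<^sub>R v) - h p - \<epsilon> *\<^sub>R h' p) \<le> M * \<epsilon> * \<epsilon>"
      using \<epsilon> by (simp add: algebra_simps)
    have "a * (t - 1) \<le> a * \<bar>fst (p + \<epsilon> *\<^sub>R v)\<bar>"
      using near[of \<epsilon>] ab \<epsilon> by (intro mult_left_mono) auto
    then have "exp (- a * \<bar>fst (p + \<epsilon> *\<^sub>R v)\<bar>) \<le> exp a * exp (- a * t)"
      unfolding exp_add[symmetric] by (simp add: algebra_simps)
    then have h1: "norm (h (p + \<epsilon> *\<^sub>R v)) \<le> C * exp a * exp (- a * t)"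
      using C(1) by (intro order_trans[OF C(2)]) (simp add: mult.assoc)
    have h0: "norm (h p) \<le> C * exp (- a * t)" using C(2) by (simp add: t_def)
    have "\<epsilon> * norm (h' p) \<le> norm (h (p + \<epsilon> *\<^sub>R v)) + norm (h p) + norm (h (p + \<epsilon> *\<^sub>R v) - h p - \<epsilon> *\<^sub>R h' p)"
    proof -
      have "norm (\<epsilon> *\<^sub>R h' p) = norm (h (p + \<epsilon> *\<^sub>R v) - h p - (h (p + \<epsilon> *\<^sub>R v) - h p - \<epsilon> *\<^sub>R h' p))"
        by simp
      then show ?thesis using \<epsilon> norm_triangle_ineq4 by (smt (verit) norm_scaleR)
    qed
    also have "\<dots> \<le> (C * exp a + C) * exp (- a * t) + M * \<epsilon> * \<epsilon>"
      using h1 h0 * by (simp add: algebra_simps)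
    also have "\<dots> = \<epsilon> * ((C * exp a + C + B * exp b) * exp (- ((a + b) / 2) * t))"
    proof -
      have e1: "exp (- a * t) = \<epsilon> * exp (- ((a + b) / 2) * t)"
        unfolding \<epsilon>_def exp_add[symmetric] by (simp add: field_simps)
      have e2: "\<epsilon> * exp (- b * t) = exp (- ((a + b) / 2) * t)"
        unfolding \<epsilon>_def exp_add[symmetric] by (simp add: field_simps)
      have "M * \<epsilon> = B * exp b * exp (- ((a + b) / 2) * t)"
        unfolding M_def e2[symmetric] by simp
      then show ?thesis unfolding e1 by (simp add: algebra_simps)
    qed
    finally show ?thesis using \<epsilon>(1) by (simp add: t_def)
  qed
  then show ?thesis by (rule exp_decayI)
qed

text \<open>Differentiation in a fixed direction does not lower the supremum of the decay rates, provided that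
the derivatives of all orders are bounded. Let \<open>\<rho> k\<close> be the supremum of the rates of the
\<open>k\<close>-th derivative, capped at \<open>a\<close> to keep it finite. If \<open>\<rho>\<close> ever
dropped by \<open>\<delta>\<close>, interpolation would make it drop by at least \<open>\<delta>\<close> at
every later step, so it would become negative.\<close>

lemma exp_decay_derivatives:
  fixes h :: "nat \<Rightarrow> real \<times> 'a::real_normed_vector \<Rightarrow> 'b::real_normed_vector"
  assumes d: "\<And>k p. ((\<lambda>s. h k (p + s *\<^sub>R v)) has_vector_derivative h (Suc k) p) (at 0)"
    and v: "\<bar>fst v\<bar> \<le> 1"
    and a: "a > 0" and bounded: "\<And>k. exp_decay 0 (h k)"
    and h0: "\<And>r. r < a \<Longrightarrow> exp_decay r (h 0)"
    and r: "r < a"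
  shows "exp_decay r (h k)"
proof -
  define S where "S k = {r \<in> {0..a}. exp_decay r (h k)}" for k
  define \<rho> where "\<rho> k = Sup (S k)" for k
  have S0: "0 \<in> S k" for k using a bounded by (simp add: S_def)
  have bdd: "bdd_above (S k)" for k by (auto simp: S_def intro: bdd_aboveI[of _ a])
  have pos: "\<rho> k \<ge> 0" for k unfolding \<rho>_def by (rule cSup_upper[OF S0 bdd])
  have below: "exp_decay r (h k)" if r: "r < \<rho> k" for r k
  proof -
    obtain s where "s \<in> S k" "r < s"
      using less_cSupD[OF _ r[unfolded \<rho>_def]] S0[of k] by blast
    then show ?thesis using exp_decay_mono[of s "h k" r] by (simp add: S_def)
  qed
  have le_a: "\<rho> k \<le> a" for k unfolding \<rho>_def using S0[of k] by (intro cSup_least) (auto simp: S_def)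
  have rho_geI: "\<rho> k \<ge> s" if "\<And>r. 0 \<le> r \<Longrightarrow> r < s \<Longrightarrow> exp_decay r (h k)" "s \<le> a" for s k
  proof (rule dense_le)
    fix r assume "r < s"
    show "r \<le> \<rho> k"
    proof (cases "r \<ge> 0")
      case True
      then have "r \<in> S k" using that \<open>r < s\<close> by (auto simp: S_def)
      then show ?thesis unfolding \<rho>_def by (rule cSup_upper[OF _ bdd])
    qed (use pos[of k] in auto)
  qed
  \<comment> \<open>Interpolation applies only when the outer rates are ordered; a drop of the rate from \<open>k\<close> to
    \<open>Suc k\<close> forces that order.\<close>
  have conc: "\<rho> (Suc k) \<ge> (\<rho> k + \<rho> (Suc (Suc k))) / 2" if "\<rho> (Suc k) < \<rho> k" for k
  proof (rule ccontr)
    assume n: "\<not> ?thesis"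
    define b where "b = \<rho> (Suc (Suc k))"
    have bk: "b \<le> \<rho> k"
    proof (rule ccontr)
      assume "\<not> b \<le> \<rho> k"
      have "\<rho> (Suc k) \<ge> \<rho> k"
      proof (rule rho_geI)
        fix r assume "0 \<le> r" "r < \<rho> k"
        then show "exp_decay r (h (Suc k))"
          using exp_decay_interpolate[of "h k" v "h (Suc k)" "h (Suc (Suc k))" r r, OF d d v] below[of r k] below[of r "Suc (Suc k)"] \<open>\<not> b \<le> \<rho> k\<close>
          by (auto simp: b_def)
      qed (rule le_a)
      then show False using that by simp
    qed
    have "\<rho> (Suc k) \<ge> (\<rho> k + b) / 2"
    proof (rule rho_geI)
      fix r assume r: "0 \<le> r" "r < (\<rho> k + b) / 2"
      define \<delta> where "\<delta> = (\<rho> k + b) / 2 - r"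
      have \<delta>: "\<delta> > 0" "r \<le> (\<rho> k - \<delta> + (b - \<delta>)) / 2 + \<delta>" using r by (auto simp: \<delta>_def field_simps)
      show "exp_decay r (h (Suc k))"
      proof (cases "b - \<delta> \<ge> 0")
        case True
        have "exp_decay ((\<rho> k - \<delta> + (b - \<delta>)) / 2) (h (Suc k))"
        proof (rule exp_decay_interpolate[of "h k" v "h (Suc k)" "h (Suc (Suc k))", OF d d v])
          show "exp_decay (\<rho> k - \<delta>) (h k)" by (rule below) (use \<delta>(1) in simp)
          show "exp_decay (b - \<delta>) (h (Suc (Suc k)))" by (rule below) (use \<delta>(1) b_def in simp)
        qed (use True bk in auto)
        moreover have "(\<rho> k - \<delta> + (b - \<delta>)) / 2 = r" by (simp add: \<delta>_def field_simps)
        ultimately show ?thesis by simp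
      next
        case False
        have b0: "b \<ge> 0" using pos by (simp add: b_def)
        have "2 * r < \<rho> k" using False b0 r by (simp add: \<delta>_def field_simps)
        have "exp_decay ((2 * r + 0) / 2) (h (Suc k))"
          by (rule exp_decay_interpolate[of "h k" v "h (Suc k)" "h (Suc (Suc k))", OF d d v])
            (use r below[OF \<open>2 * r < \<rho> k\<close>] bounded in auto)
        then show ?thesis by simp
      qed
    qed (use le_a[of k] le_a[of "Suc (Suc k)"] in \<open>simp add: b_def\<close>)
    then show False using n by (simp add: b_def)
  qed
  have incr: "\<rho> k \<le> \<rho> (Suc k)" for k
  proof (rule ccontr)
    assume n: "\<not> \<rho> k \<le> \<rho> (Suc k)"
    define \<delta> where "\<delta> = \<rho> k - \<rho> (Suc k)"
    have \<delta>: "\<delta> > 0" using n by (simp add: \<delta>_def)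
    have step: "\<rho> (k + m) - \<rho> (Suc (k + m)) \<ge> \<delta>" for m
    proof (induction m)
      case (Suc m)
      then show ?case using conc[of "k + m"] \<delta> by (simp add: field_simps)
    qed (simp add: \<delta>_def)
    have "\<rho> (k + m) \<le> \<rho> k - m * \<delta>" for m
    proof (induction m)
      case (Suc m)
      then show ?case using step[of m] by (simp add: algebra_simps)
    qed simp
    moreover obtain m :: nat where "m * \<delta> > \<rho> k" using reals_Archimedean3[OF \<delta>] by blast
    ultimately show False using pos[of "k + m"] by (smt (verit))
  qed
  have "a \<le> \<rho> 0" by (rule rho_geI) (use h0 in auto)
  also have "\<rho> 0 \<le> \<rho> k" using incr by (metis le0 lift_Suc_mono_le)
  finally show ?thesis using r below by auto
qed

section \<open>Fourier integrals over space-time\<close>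

lemma integrable_exp_minus_abs:
  assumes "c > 0"
  shows "integrable lborel (\<lambda>t::real. exp (- c * \<bar>t\<bar>))"
proof -
  have pos: "integrable lborel (\<lambda>x::real. exp (-x) * indicator {0<..} x)"
    using integrable.intros[OF has_bochner_integral_I0i_power_exp_m[of 0]] by simp
  have neg: "integrable lborel (\<lambda>x::real. exp x * indicator {..<0} x)"
    using lborel_integrable_real_affine[OF pos, of "-1" 0]
    by (simp add: indicator_def)
  have "integrable lborel (\<lambda>x::real. exp (- \<bar>x\<bar>))"
  proof (rule Bochner_Integration.integrable_bound[OF Bochner_Integration.integrable_add[OF pos neg]])
    show "AE x::real in lborel. norm (exp (- \<bar>x\<bar>))
        \<le> norm (exp (- x) * indicator {0<..} x + exp x * indicator {..<0} x)"
      using AE_lborel_singleton[of "0::real"] by eventually_elim (auto simp: indicator_def)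
  qed simp
  from lborel_integrable_real_affine[OF this, of c 0] assms show ?thesis
    by (simp add: abs_mult)
qed

lemma integrable_lborel_translate:
  fixes f :: "'a::euclidean_space \<Rightarrow> 'b::{banach, second_countable_topology}"
  assumes "integrable lborel f"
  shows "integrable lborel (\<lambda>x. f (x + a))"
proof -
  have "integrable (distr lborel borel ((+) a)) f" using assms by (simp add: lborel_distr_plus)
  then show ?thesis using assms by (subst (asm) integrable_distr_eq) (auto simp: add.commute)
qed

lemma integral_lborel_translate:
  fixes f :: "'a::euclidean_space \<Rightarrow> 'b::{banach, second_countable_topology}"
  assumes [measurable]: "f \<in> borel_measurable borel"
  shows "(\<integral>x. f (x + a) \<partial>lborel) = (\<integral>x. f x \<partial>lborel)"
proof -
  have "(\<integral>x. f x \<partial>lborel) = (\<integral>x. f x \<partial>distr lborel borel ((+) a))" by (simp add: lborel_distr_plus)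
  also have "\<dots> = (\<integral>x. f (a + x) \<partial>lborel)" by (rule integral_distr) auto
  finally show ?thesis by (simp add: add.commute)
qed

lemma integrable_exp_decay_weight:
  fixes R :: real
  assumes "c > 0"
  shows "integrable (lborel :: (real \<times> 'a::euclidean_space) measure)
    (\<lambda>p. exp (- c * \<bar>fst p\<bar>) * indicator (cball 0 R) (snd p))"
proof -
  have [measurable]: "(cball 0 R :: 'a set) \<in> sets borel" by simp
  have "integrable (lborel \<Otimes>\<^sub>M lborel)
    (\<lambda>p :: real \<times> 'a. exp (- c * \<bar>fst p\<bar>) * indicator (cball 0 R) (snd p))"
  proof (rule lborel_pair.Fubini_integrable)
    have fin: "integrable lborel (indicator (cball 0 R) :: 'a \<Rightarrow> real)"
      using emeasure_lborel_cball_finite[of "0::'a" R] by (intro integrable_real_indicator) (auto simp: top.not_eq_extremum)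
    have "integrable lborel (\<lambda>x. exp (- c * \<bar>x\<bar>) * measure lborel (cball 0 R :: 'a set))"
      using integrable_exp_minus_abs[OF assms] by simp
    then show "integrable lborel (\<lambda>x. \<integral>y. norm (exp (- c * \<bar>fst (x, y)\<bar>) *
        indicator (cball 0 R) (snd (x, y) :: 'a)) \<partial>lborel)"
      by (simp add: abs_mult)
    show "AE x in lborel. integrable lborel (\<lambda>y. exp (- c * \<bar>fst (x, y)\<bar>) * indicator (cball 0 R) (snd (x, y) :: 'a))"
      using fin by simp
  qed measurable
  then show ?thesis by (simp add: lborel_prod)
qed

lemma integrable_if_exp_decay:
  fixes h :: "real \<times> 'a::euclidean_space \<Rightarrow> 'b::{banach, second_countable_topology}"
  assumes "continuous_on UNIV h" and "exp_decay c h" and "c > 0"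
    and "\<And>p. norm (snd p) > R \<Longrightarrow> h p = 0"
  shows "integrable lborel h"
proof -
  obtain C where C: "C > 0" "\<And>p. norm (h p) \<le> C * exp (- c * \<bar>fst p\<bar>)"
    using exp_decayD[OF assms(2)] by blast
  have "integrable lborel (\<lambda>p::real \<times> 'a. C * (exp (- c * \<bar>fst p\<bar>) * indicator (cball 0 R) (snd p)))"
    by (intro integrable_mult_right integrable_exp_decay_weight assms)
  then show ?thesis
  proof (rule Bochner_Integration.integrable_bound)
    show "h \<in> borel_measurable lborel"
      using borel_measurable_continuous_onI[OF assms(1)] by simp
    have "norm (h p) \<le> norm (C * (exp (- c * \<bar>fst p\<bar>) * indicator (cball 0 R) (snd p)))" for p
      using C assms(4)[of p] by (cases "norm (snd p) > R") (auto simp: abs_mult)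
    then show "AE p in lborel. norm (h p) \<le> norm (C * (exp (- c * \<bar>fst p\<bar>) * indicator (cball 0 R) (snd p)))"
      by simp
  qed
qed

text \<open>By translation invariance every difference quotient of \<open>h\<close> has integral zero;
dominated convergence passes to the limit. The dominating function is a decaying weight on a slightly larger
tube, since the quotients are averages of \<open>h'\<close> over segments of length at most \<open>norm
v\<close>.\<close>

lemma integral_directional_derivative_eq_0:
  fixes h :: "real \<times> 'a::euclidean_space \<Rightarrow> complex"
  assumes d: "\<And>p. ((\<lambda>s. h (p + s *\<^sub>R v)) has_vector_derivative h' p) (at 0)"
    and cont: "continuous_on UNIV h" "continuous_on UNIV h'"
    and decay: "exp_decay c h" "exp_decay c h'" "c > 0"
    and supp: "\<And>p. norm (snd p) > R \<Longrightarrow> h p = 0" "\<And>p. norm (snd p) > R \<Longrightarrow> h' p = 0"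
  shows "(\<integral>p. h' p \<partial>lborel) = 0"
proof -
  define e where "e n = inverse (real (Suc n))" for n
  have e: "0 < e n" "e n \<le> 1" for n by (auto simp: e_def field_simps)
  have e0: "e \<longlonglongrightarrow> 0" unfolding e_def by (rule LIMSEQ_inverse_real_of_nat)
  define q where "q n p = (h (p + e n *\<^sub>R v) - h p) /\<^sub>R e n" for n p
  obtain C where C: "C > 0" "\<And>p. norm (h' p) \<le> C * exp (- c * \<bar>fst p\<bar>)"
    using decay(2) by (auto dest: exp_decayD)
  define w where "w p = C * exp (c * norm v) * (exp (- c * \<bar>fst p\<bar>) * indicator (cball 0 (R + norm v)) (snd p))"
    for p :: "real \<times> 'a"
  note [measurable] = borel_measurable_continuous_onI[OF cont(1)] borel_measurable_continuous_onI[OF cont(2)]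
  have int_h: "integrable lborel h" by (rule integrable_if_exp_decay[OF cont(1) decay(1,3) supp(1)])
  have shift: "((\<lambda>s. h (p + s *\<^sub>R v)) has_vector_derivative h' (p + s *\<^sub>R v)) (at s)" for p s
    using d[of "p + s *\<^sub>R v"]
    by (simp add: has_vector_derivative_def has_derivative_at algebra_simps)
  have bound: "norm (q n p) \<le> w p" for n p
  proof -
    have "norm (h' (p + s *\<^sub>R v)) \<le> w p" if s: "s \<in> {0..1}" for s
    proof (cases "norm (snd p) > R + norm v")
      case True
      have "norm (s *\<^sub>R snd v) \<le> 1 * norm v"
        unfolding norm_scaleR using s norm_snd_le[of "snd v" "fst v"] by (intro mult_mono) auto
      then have "norm (snd (p + s *\<^sub>R v)) > R"
        using True norm_diff_ineq[of "snd p" "s *\<^sub>R snd v"] by simp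
      then show ?thesis using C(1) by (simp add: w_def supp(2))
    next
      case False
      have "\<bar>s * fst v\<bar> \<le> 1 * norm v"
        unfolding abs_mult using s norm_fst_le[of "fst v" "snd v"] by (intro mult_mono) auto
      then have "c * (\<bar>fst p\<bar> - norm v) \<le> c * \<bar>fst (p + s *\<^sub>R v)\<bar>"
        using decay(3) by (intro mult_left_mono) auto
      then have "exp (- c * \<bar>fst (p + s *\<^sub>R v)\<bar>) \<le> exp (c * norm v) * exp (- c * \<bar>fst p\<bar>)"
        unfolding exp_add[symmetric] by (simp add: algebra_simps)
      then show ?thesis
        using False C(1) by (intro order_trans[OF C(2)]) (simp add: w_def mult.assoc)
    qed
    then have "norm (h (p + e n *\<^sub>R v) - h (p + 0 *\<^sub>R v)) \<le> w p * e n"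
      by (intro norm_diff_le_vector_derivative_bound[where \<epsilon> = 1, OF shift]) (use e[of n] in auto)
    moreover have "norm (q n p) = norm (h (p + e n *\<^sub>R v) - h p) / e n"
      using e[of n] unfolding q_def norm_scaleR by (simp add: divide_inverse mult.commute)
    ultimately show ?thesis using e[of n] by (simp add: pos_divide_le_eq)

  qed
  have "(\<lambda>n. \<integral>p. q n p \<partial>lborel) \<longlonglongrightarrow> (\<integral>p. h' p \<partial>lborel)"
  proof (rule integral_dominated_convergence)
    show "integrable lborel w"
      unfolding w_def by (intro integrable_mult_right integrable_exp_decay_weight decay)
    have "(\<lambda>n. q n p) \<longlonglongrightarrow> h' p" for p
    proof -
      have "((\<lambda>s. (h (p + s *\<^sub>R v) - h p) /\<^sub>R s) \<longlongrightarrow> h' p) (at 0)"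
      proof -
        have "((\<lambda>s. norm (h (p + s *\<^sub>R v) - h p - s *\<^sub>R h' p) / norm s) \<longlongrightarrow> 0) (at 0)"
          using d[of p] by (simp add: has_vector_derivative_def has_derivative_at)
        then have "((\<lambda>s. norm ((h (p + s *\<^sub>R v) - h p) /\<^sub>R s - h' p)) \<longlongrightarrow> 0) (at 0)"
        proof (rule Lim_transform_eventually)
          have "norm (h (p + s *\<^sub>R v) - h p - s *\<^sub>R h' p) / norm s = norm ((h (p + s *\<^sub>R v) - h p) /\<^sub>R s - h' p)"
            if "s \<noteq> 0" for s
          proof -
            have "(h (p + s *\<^sub>R v) - h p) /\<^sub>R s - h' p = (h (p + s *\<^sub>R v) - h p - s *\<^sub>R h' p) /\<^sub>R s"
              using that by (simp add: scaleR_diff_right)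
            then show ?thesis by (simp add: divide_inverse mult.commute)
          qed
          then show "\<forall>\<^sub>F s in at 0. norm (h (p + s *\<^sub>R v) - h p - s *\<^sub>R h' p) / norm s
              = norm ((h (p + s *\<^sub>R v) - h p) /\<^sub>R s - h' p)"
            by (auto simp: eventually_at_filter)
        qed
        then show ?thesis by (simp only: tendsto_norm_zero_iff LIM_zero_iff)
      qed
      moreover have "filterlim e (at 0) sequentially"
        using e0 e(1) by (simp add: filterlim_at less_imp_neq[THEN not_sym])
      ultimately show ?thesis unfolding q_def by (rule filterlim_compose)
    qed
    then show "AE p in lborel. (\<lambda>n. q n p) \<longlonglongrightarrow> h' p" by simp
    show "AE p in lborel. norm (q n p) \<le> w p" for n using bound by simp
    show "q n \<in> borel_measurable lborel" for n unfolding q_def by measurable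
  qed measurable
  moreover have "(\<integral>p. q n p \<partial>lborel) = 0" for n
    unfolding q_def using integrable_lborel_translate[OF int_h] int_h
    by (simp add: integral_lborel_translate)
  ultimately show ?thesis by (simp add: LIMSEQ_const_iff)
qed

lemma exp_decay_iexp_mult: "exp_decay c f \<Longrightarrow> exp_decay c (\<lambda>p. iexp (\<zeta> \<bullet> p) * f p)"
  by (simp add: exp_decay_def norm_mult)

lemma exp_decay_add:
  assumes "exp_decay c f" "exp_decay c g"
  shows "exp_decay c (\<lambda>p. f p + g p)"
proof -
  obtain B where B: "\<And>p. norm (f p) \<le> B * exp (- c * \<bar>fst p\<bar>)"
    using exp_decayD[OF assms(1)] by blast
  obtain C where C: "\<And>p. norm (g p) \<le> C * exp (- c * \<bar>fst p\<bar>)"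
    using exp_decayD[OF assms(2)] by blast
  have "norm (f p + g p) \<le> (B + C) * exp (- c * \<bar>fst p\<bar>)" for p
    using norm_triangle_mono[OF B C] by (simp add: algebra_simps)
  then show ?thesis by (rule exp_decayI)
qed

lemma exp_decay_mult_left:
  fixes f :: "real \<times> 'a \<Rightarrow> complex"
  assumes "exp_decay c f"
  shows "exp_decay c (\<lambda>p. z * f p)"
proof -
  obtain B where B: "\<And>p. norm (f p) \<le> B * exp (- c * \<bar>fst p\<bar>)"
    using exp_decayD[OF assms(1)] by blast
  have "norm (z * f p) \<le> (norm z * B) * exp (- c * \<bar>fst p\<bar>)" for p
    using mult_left_mono[OF B, of "norm z"] by (simp add: norm_mult mult.assoc)
  then show ?thesis by (rule exp_decayI)
qed

lemma fourier_directional_derivative: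
  fixes f :: "real \<times> 'a::euclidean_space \<Rightarrow> complex"
  assumes d: "\<And>p. ((\<lambda>s. f (p + s *\<^sub>R v)) has_vector_derivative f' p) (at 0)"
    and cont: "continuous_on UNIV f" "continuous_on UNIV f'"
    and decay: "exp_decay c f" "exp_decay c f'" "c > 0"
    and supp: "\<And>p. norm (snd p) > R \<Longrightarrow> f p = 0" "\<And>p. norm (snd p) > R \<Longrightarrow> f' p = 0"
  shows "(\<integral>p. iexp (\<zeta> \<bullet> p) * f' p \<partial>lborel) = - \<i> * of_real (\<zeta> \<bullet> v) * (\<integral>p. iexp (\<zeta> \<bullet> p) * f p \<partial>lborel)"
proof -
  let ?g = "\<lambda>p. \<i> * of_real (\<zeta> \<bullet> v) * (iexp (\<zeta> \<bullet> p) * f p)"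
  have cg: "continuous_on UNIV (\<lambda>p. iexp (\<zeta> \<bullet> p) * f p)" "continuous_on UNIV (\<lambda>p. iexp (\<zeta> \<bullet> p) * f' p)"
    "continuous_on UNIV ?g"
    by (intro continuous_intros cont)+
  have dg: "exp_decay c ?g"
    by (intro exp_decay_mult_left exp_decay_iexp_mult decay)
  have "(\<integral>p. ?g p + iexp (\<zeta> \<bullet> p) * f' p \<partial>lborel) = 0"
  proof (rule integral_directional_derivative_eq_0[where h = "\<lambda>p. iexp (\<zeta> \<bullet> p) * f p" and v = v and c = c and R = R])
    show "((\<lambda>s. iexp (\<zeta> \<bullet> (p + s *\<^sub>R v)) * f (p + s *\<^sub>R v)) has_vector_derivative
          ?g p + iexp (\<zeta> \<bullet> p) * f' p) (at 0)" for p
    proof -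
      have *: "((\<lambda>s. iexp (\<zeta> \<bullet> (p + s *\<^sub>R v))) has_vector_derivative \<i> * of_real (\<zeta> \<bullet> v) * iexp (\<zeta> \<bullet> p)) (at 0)"
      proof -
        have "((\<lambda>z. exp (\<i> * (of_real (\<zeta> \<bullet> p) + z * of_real (\<zeta> \<bullet> v)))) has_field_derivative
            \<i> * of_real (\<zeta> \<bullet> v) * iexp (\<zeta> \<bullet> p)) (at (of_real 0))"
          by (auto intro!: derivative_eq_intros)
        from has_vector_derivative_real_field[OF this] show ?thesis
          by (simp add: inner_add_right algebra_simps)
      qed
      from has_vector_derivative_mult[OF * d[of p]] show ?thesis by (simp add: algebra_simps)
    qed
    show "continuous_on UNIV (\<lambda>p. ?g p + iexp (\<zeta> \<bullet> p) * f' p)" by (intro continuous_intros cont)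
  qed (use supp cg decay dg in \<open>auto intro!: exp_decay_iexp_mult exp_decay_add\<close>)
  moreover have "integrable lborel ?g"
    by (rule integrable_if_exp_decay[OF cg(3) dg decay(3), where R = R]) (simp add: supp)
  moreover have "integrable lborel (\<lambda>p. iexp (\<zeta> \<bullet> p) * f' p)"
    by (rule integrable_if_exp_decay[OF cg(2) exp_decay_iexp_mult[OF decay(2)] decay(3), where R = R]) (simp add: supp)
  ultimately show ?thesis by (simp add: add_eq_0_iff2)
qed

text \<open>The shear \<open>(t, x) \<mapsto> (t, x + t \<omega>)\<close> preserves volume and straightens the
rays in direction \<open>(1, \<omega>)\<close>. As \<open>\<zeta>\<close> is orthogonal to that direction, the
character \<open>e^(i \<zeta> \<bullet> p)\<close> is constant along each of them, so by Fubini the Fourier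
integral is a superposition of ray integrals.\<close>

lemma fourier_light_ray_slice:
  fixes F :: "real \<times> 'a::euclidean_space \<Rightarrow> complex"
  assumes cont: "continuous_on UNIV F" and decay: "exp_decay c F" "c > 0"
    and supp: "\<And>p. norm (snd p) > R \<Longrightarrow> F p = 0"
    and rays: "\<And>x. (\<integral>s. F (s, x + s *\<^sub>R \<omega>) \<partial>lborel) = 0"
    and orth: "\<zeta> \<bullet> (1, \<omega>) = 0"
  shows "(\<integral>p. iexp (\<zeta> \<bullet> p) * F p \<partial>lborel) = 0"
proof -
  define H where "H p = iexp (\<zeta> \<bullet> p) * F p" for p
  have cH: "continuous_on UNIV H" unfolding H_def by (intro continuous_intros cont)
  have iH: "integrable lborel H"
    by (rule integrable_if_exp_decay[OF cH _ decay(2), where R = R])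
      (use exp_decay_iexp_mult[OF decay(1), of \<zeta>] supp in \<open>simp_all add: H_def[abs_def]\<close>)
  then have iH': "integrable (lborel \<Otimes>\<^sub>M lborel) H" by (simp add: lborel_prod)
  have mH[measurable]: "H \<in> borel_measurable (borel \<Otimes>\<^sub>M borel)"
    using borel_measurable_continuous_onI[OF cH] by (simp add: borel_prod)
  define K where "K = (\<lambda>(t, x). H (t, x + t *\<^sub>R \<omega>))"
  have mK: "K \<in> borel_measurable (lborel \<Otimes>\<^sub>M lborel)"
  proof -
    have "continuous_on UNIV (\<lambda>p. H (fst p, snd p + fst p *\<^sub>R \<omega>))"
      by (rule continuous_on_compose2[OF cH]) (auto intro!: continuous_intros)
    then have "(\<lambda>p. H (fst p, snd p + fst p *\<^sub>R \<omega>)) \<in> borel_measurable borel"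
      by (rule borel_measurable_continuous_onI)
    then show ?thesis by (simp add: K_def case_prod_beta' lborel_prod)
  qed
  have trans: "(\<integral>x. norm (H (t, x + t *\<^sub>R \<omega>)) \<partial>lborel) = (\<integral>x. norm (H (t, x)) \<partial>lborel)"
      "(\<integral>x. H (t, x + t *\<^sub>R \<omega>) \<partial>lborel) = (\<integral>x. H (t, x) \<partial>lborel)" for t
    by (rule integral_lborel_translate[of "\<lambda>x. norm (H (t, x))"]; measurable)
      (rule integral_lborel_translate[of "\<lambda>x. H (t, x)"]; measurable)
  have iK: "integrable (lborel \<Otimes>\<^sub>M lborel) K"
  proof (rule lborel_pair.Fubini_integrable[OF mK])
    have "integrable lborel (\<lambda>t. \<integral>x. norm (H (t, x)) \<partial>lborel)"
      using lborel_pair.integrable_fst'[OF integrable_norm[OF iH']] by simp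
    then show "integrable lborel (\<lambda>t. \<integral>x. norm (K (t, x)) \<partial>lborel)"
      by (simp add: K_def trans)
    have "AE t in lborel. integrable lborel (\<lambda>x. H (t, x))"
      using lborel_pair.AE_integrable_fst'[OF iH'] by simp
    then show "AE t in lborel. integrable lborel (\<lambda>x. K (t, x))"
      by eventually_elim (auto simp: K_def intro: integrable_lborel_translate)
  qed
  have "(\<integral>p. H p \<partial>lborel) = (\<integral>t. \<integral>x. H (t, x) \<partial>lborel \<partial>lborel)"
    using lborel_pair.integral_fst'[OF iH'] by (simp add: lborel_prod)
  also have "\<dots> = (\<integral>t. \<integral>x. K (t, x) \<partial>lborel \<partial>lborel)"
    by (simp add: K_def trans)
  also have "\<dots> = (\<integral>x. \<integral>t. K (t, x) \<partial>lborel \<partial>lborel)"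
    by (rule lborel_pair.Fubini_integral[of "\<lambda>t x. K (t, x)", symmetric]) (use iK in simp)
  also have "\<dots> = integral\<^sup>L lborel (\<lambda>x::'a. 0)"
  proof (rule Bochner_Integration.integral_cong[OF refl])
    fix x
    have "\<zeta> \<bullet> (t, x + t *\<^sub>R \<omega>) = \<zeta> \<bullet> (0, x)" for t
    proof -
      have "\<zeta> \<bullet> (t, x + t *\<^sub>R \<omega>) = \<zeta> \<bullet> ((0, x) + t *\<^sub>R (1, \<omega>))" by simp
      then show ?thesis using orth by (simp only: inner_add_right inner_scaleR_right)
    qed
    then show "(\<integral>t. K (t, x) \<partial>lborel) = 0"
      using rays[of x] by (simp add: K_def H_def)
  qed
  finally show ?thesis by (simp add: H_def)
qed

section \<open>Uniqueness of the Fourier transform\<close>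

lemma continuous_AE_zero_imp_zero:
  fixes f :: "'a::euclidean_space \<Rightarrow> 'b::real_normed_vector"
  assumes "continuous_on UNIV f" and ae: "AE x in lborel. f x = 0"
  shows "f x = 0"
proof -
  let ?S = "{x. f x \<noteq> 0}"
  have op: "open ?S"
    using assms(1) by (intro open_Collect_neq) (auto intro: continuous_intros)
  moreover have "AE x in lborel. x \<notin> ?S" using ae by simp
  ultimately have "?S \<in> null_sets lborel"
    by (subst AE_iff_null_sets) auto
  then have "negligible ?S"
    by (simp add: negligible_iff_null_sets null_sets_completionI)
  then have "?S = {}" using open_not_negligible[OF op] by blast
  then show ?thesis by blast
qed

lemma continuous_integral_zero_imp_zero:
  fixes f :: "'a::euclidean_space \<Rightarrow> real"
  assumes "continuous_on UNIV f" "integrable lborel f" "\<And>x. f x \<ge> 0" "(\<integral>x. f x \<partial>lborel) = 0"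
  shows "f x = 0"
proof (rule continuous_AE_zero_imp_zero[OF assms(1)])
  show "AE x in lborel. f x = 0"
    using integral_nonneg_eq_0_iff_AE[OF assms(2)] assms(3,4) by simp
qed

text \<open>The positive and negative parts of \<open>h\<close> have equal Fourier transforms, hence equal
total mass. Were the mass positive, normalising them would give two probability measures with equal
characteristic functions; these would coincide by Levy's theorem, although they live on disjoint sets.\<close>

lemma real_eq_0_if_fourier_eq_0:
  fixes h :: "real \<Rightarrow> real"
  assumes cont: "continuous_on UNIV h" and int: "integrable lborel h"
    and zero: "\<And>\<tau>. (\<integral>t. iexp (\<tau> * t) * of_real (h t) \<partial>lborel) = 0"
  shows "h t = 0"
proof -
  define P where "P t = max 0 (h t)" for t
  define N where "N t = max 0 (- h t)" for t
  have hPN: "h t = P t - N t" for t by (simp add: P_def N_def)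
  have cPN: "continuous_on UNIV P" "continuous_on UNIV N"
    unfolding P_def N_def by (intro continuous_intros cont)+
  have [measurable]: "P \<in> borel_measurable borel" "N \<in> borel_measurable borel"
    using cPN by (auto intro: borel_measurable_continuous_onI)
  have nonneg: "P t \<ge> 0" "N t \<ge> 0" for t by (auto simp: P_def N_def)
  have iP: "integrable lborel P" and iN: "integrable lborel N"
    using int unfolding P_def N_def by (auto intro!: integrable_max)
  have iE: "integrable lborel (\<lambda>t. iexp (\<tau> * t) * of_real (Q t))" if "integrable lborel Q" for Q :: "real \<Rightarrow> real" and \<tau>
    by (rule Bochner_Integration.integrable_bound[OF that])
      (use that in \<open>auto simp: norm_mult\<close>)
  have eq: "(\<integral>t. iexp (\<tau> * t) * of_real (P t) \<partial>lborel) = (\<integral>t. iexp (\<tau> * t) * of_real (N t) \<partial>lborel)" for \<tau>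
    using zero[of \<tau>] iE[OF iP, of \<tau>] iE[OF iN, of \<tau>] by (simp add: hPN algebra_simps)
  define m where "m = (\<integral>t. P t \<partial>lborel)"
  have m: "m = (\<integral>t. N t \<partial>lborel)"
  proof -
    have "complex_of_real m = of_real (\<integral>t. N t \<partial>lborel)"
      using eq[of 0] by (simp add: m_def)
    then show ?thesis by (simp only: of_real_eq_iff)
  qed
  have "m \<ge> 0" unfolding m_def using nonneg by simp
  have "m = 0"
  proof (rule ccontr)
    assume "m \<noteq> 0"
    with \<open>m \<ge> 0\<close> have "m > 0" by simp
    define D where "D Q = density lborel (\<lambda>t. ennreal (Q t / m))" for Q :: "real \<Rightarrow> real"
    have D: "real_distribution (D Q)" if "Q \<in> {P, N}" for Q
    proof -
      have [measurable]: "Q \<in> borel_measurable borel" using that by auto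
      have "(\<integral>\<^sup>+ t. ennreal (Q t / m) \<partial>lborel) = ennreal (\<integral>t. Q t / m \<partial>lborel)"
        using that iP iN nonneg \<open>m > 0\<close> by (intro nn_integral_eq_integral) auto
      also have "\<dots> = 1" using that m \<open>m > 0\<close> by (auto simp: m_def)
      finally have "emeasure (D Q) (space (D Q)) = 1" by (simp add: D_def emeasure_density)
      then have "prob_space (D Q)" by (rule prob_spaceI)
      then show ?thesis
        unfolding real_distribution_def real_distribution_axioms_def by (simp add: D_def)
    qed
    have ch: "char (D Q) \<tau> = (\<integral>t. iexp (\<tau> * t) * of_real (Q t) \<partial>lborel) / m" if "Q \<in> {P, N}" for Q \<tau>
    proof -
      have [measurable]: "Q \<in> borel_measurable borel" using that by auto
      have "char (D Q) \<tau> = (\<integral>t. (Q t / m) *\<^sub>R iexp (\<tau> * t) \<partial>lborel)"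
        unfolding char_def D_def using that nonneg \<open>m > 0\<close>
        by (intro integral_density) auto
      also have "\<dots> = (\<integral>t. iexp (\<tau> * t) * of_real (Q t) / m \<partial>lborel)"
        by (simp add: scaleR_conv_of_real algebra_simps)
      finally show ?thesis by simp
    qed
    have "D P = D N"
    proof (rule Levy_uniqueness)
      show "char (D P) = char (D N)"
        by (rule ext) (simp only: ch eq insertI1 insertI2)
    qed (simp_all add: D)
    moreover have "emeasure (D P) {t. h t > 0} = 1"
    proof -
      have "{t. h t > 0} \<in> sets lborel"
        using cont by (simp add: open_Collect_less)
      then have "emeasure (D P) {t. h t > 0} = (\<integral>\<^sup>+ t. ennreal (P t / m) * indicator {t. h t > 0} t \<partial>lborel)"
        by (simp add: D_def emeasure_density)
      also have "\<dots> = (\<integral>\<^sup>+ t. ennreal (P t / m) \<partial>lborel)"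
        by (intro nn_integral_cong) (auto simp: indicator_def P_def)
      also have "\<dots> = emeasure (D P) (space (D P))" by (simp add: D_def emeasure_density)
      finally show ?thesis using D[of P] by (simp add: real_distribution_def prob_space.emeasure_space_1)
    qed
    moreover have "emeasure (D N) {t. h t > 0} = 0"
    proof -
      have "{t. h t > 0} \<in> sets lborel"
        using cont by (simp add: open_Collect_less)
      then have "emeasure (D N) {t. h t > 0} = (\<integral>\<^sup>+ t. ennreal (N t / m) * indicator {t. h t > 0} t \<partial>lborel)"
        by (simp add: D_def emeasure_density)
      also have "\<dots> = (\<integral>\<^sup>+ t. 0 \<partial>(lborel :: real measure))"
        by (intro nn_integral_cong) (auto simp: indicator_def N_def)
      finally show ?thesis by simp
    qed
    ultimately show False by simp
  qed
  then have "P t = 0" "N t = 0"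
    using continuous_integral_zero_imp_zero[OF cPN(1) iP nonneg(1)]
      continuous_integral_zero_imp_zero[OF cPN(2) iN nonneg(2)] m m_def by auto
  then show ?thesis by (simp add: hPN)
qed

lemma eq_0_if_fourier_eq_0:
  fixes G :: "real \<Rightarrow> complex"
  assumes cont: "continuous_on UNIV G" and int: "integrable lborel G"
    and zero: "\<And>\<tau>. (\<integral>t. iexp (\<tau> * t) * G t \<partial>lborel) = 0"
  shows "G t = 0"
proof -
  have iE: "integrable lborel (\<lambda>t. iexp (\<tau> * t) * Q t)" if "integrable lborel Q" for Q :: "real \<Rightarrow> complex" and \<tau>
    by (rule Bochner_Integration.integrable_bound[OF that])
      (use that in \<open>auto simp: norm_mult\<close>)
  have icnj: "integrable lborel (\<lambda>t. cnj (G t))" using int by simp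
  have zero_cnj: "(\<integral>t. iexp (\<tau> * t) * cnj (G t) \<partial>lborel) = 0" for \<tau>
  proof -
    have "(\<integral>t. iexp (\<tau> * t) * cnj (G t) \<partial>lborel) = (\<integral>t. cnj (iexp (- \<tau> * t) * G t) \<partial>lborel)"
      by (simp add: exp_cnj)
    also have "\<dots> = cnj (\<integral>t. iexp (- \<tau> * t) * G t \<partial>lborel)" by (rule Bochner_Integration.integral_cnj)
    finally show ?thesis by (simp only: zero) simp
  qed
  have "Re (G t) = 0"
  proof (rule real_eq_0_if_fourier_eq_0[of "\<lambda>t. Re (G t)"])
    have "(\<integral>t. iexp (\<tau> * t) * of_real (Re (G t)) \<partial>lborel)
        = (\<integral>t. (iexp (\<tau> * t) * G t + iexp (\<tau> * t) * cnj (G t)) / 2 \<partial>lborel)" for \<tau>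
      by (intro Bochner_Integration.integral_cong refl)
        (simp add: distrib_left[symmetric] complex_add_cnj)
    then show "(\<integral>t. iexp (\<tau> * t) * of_real (Re (G t)) \<partial>lborel) = 0" for \<tau>
      using zero zero_cnj iE[OF int] iE[OF icnj] by simp
  qed (use int in \<open>auto intro!: continuous_intros cont\<close>)
  moreover have "Im (G t) = 0"
  proof (rule real_eq_0_if_fourier_eq_0[of "\<lambda>t. Im (G t)"])
    have "(\<integral>t. iexp (\<tau> * t) * of_real (Im (G t)) \<partial>lborel)
        = (\<integral>t. (iexp (\<tau> * t) * G t - iexp (\<tau> * t) * cnj (G t)) / (2 * \<i>) \<partial>lborel)" for \<tau>
    proof (intro Bochner_Integration.integral_cong refl)
      fix t
      have "G t - cnj (G t) = 2 * \<i> * of_real (Im (G t))" by (simp add: complex_eq_iff)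
      then have "of_real (Im (G t)) = (G t - cnj (G t)) / (2 * \<i>)" by simp
      then show "iexp (\<tau> * t) * of_real (Im (G t)) = (iexp (\<tau> * t) * G t - iexp (\<tau> * t) * cnj (G t)) / (2 * \<i>)"
        by (simp only: right_diff_distrib times_divide_eq_right)
    qed
    then show "(\<integral>t. iexp (\<tau> * t) * of_real (Im (G t)) \<partial>lborel) = 0" for \<tau>
      using zero zero_cnj iE[OF int] iE[OF icnj] by simp
  qed (use int in \<open>auto intro!: continuous_intros cont\<close>)
  ultimately show ?thesis by (simp add: complex_eq_iff)
qed

text \<open>The truncated integrals over \<open>[-n, n]\<close> are entire, and on a disc inside the strip
they converge uniformly, because the integrand is dominated there by an exponentially decaying
function.\<close>

lemma fourier_holomorphic_on_strip:
  fixes G :: "real \<Rightarrow> complex"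
  assumes cont: "continuous_on UNIV G" and bound: "\<And>t. norm (G t) \<le> C * exp (- c * \<bar>t\<bar>)"
  shows "(\<lambda>z. \<integral>t. exp (\<i> * z * of_real t) * G t \<partial>lborel) holomorphic_on {z. \<bar>Im z\<bar> < c}"
proof (rule holomorphic_uniform_sequence)
  let ?S = "{z. \<bar>Im z\<bar> < c}"
  let ?f = "\<lambda>z t. exp (\<i> * z * complex_of_real t) * G t"
  have C0: "C \<ge> 0" using order_trans[OF norm_ge_zero bound[of 0]] by simp
  show "open ?S" by (intro open_Collect_less continuous_intros)
  show "(\<lambda>z. integral (cbox (- real n) (real n)) (?f z)) holomorphic_on ?S" for n
  proof (rule leibniz_rule_holomorphic)
    show "((\<lambda>z. ?f z t) has_field_derivative \<i> * of_real t * ?f z t) (at z within ?S)" for z t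
      by (auto intro!: derivative_eq_intros)
    show "?f z integrable_on cbox (- real n) (real n)" for z
      by (intro integrable_continuous continuous_intros continuous_on_subset[OF cont]) auto
    show "continuous_on (?S \<times> cbox (- real n) (real n)) (\<lambda>(z, t). \<i> * of_real t * ?f z t)"
      unfolding case_prod_beta'
      by (intro continuous_intros continuous_on_compose2[OF cont]) auto
    have "convex {z::complex. Im z < c}" "convex {z. Im z > - c}"
      by (rule convex_halfspace_Im_lt convex_halfspace_Im_gt)+
    moreover have "?S = {z. Im z < c} \<inter> {z. Im z > - c}" by auto
    ultimately show "convex ?S" by (simp add: convex_Int)
  qed
  fix z0 assume z0: "z0 \<in> ?S"
  define d where "d = (c - \<bar>Im z0\<bar>) / 2"
  have d: "d > 0" using z0 by (simp add: d_def)
  have Im: "\<bar>Im z\<bar> \<le> c - d" if "z \<in> cball z0 d" for z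
    using that abs_Im_le_cmod[of "z - z0"] by (auto simp: d_def dist_norm norm_minus_commute field_simps)
  have sub: "cball z0 d \<subseteq> ?S" using Im d by fastforce
  have fb: "norm (?f z t) \<le> C * exp (- d * \<bar>t\<bar>)" if "z \<in> cball z0 d" for z t
  proof -
    have "- (Im z * t) \<le> \<bar>Im z\<bar> * \<bar>t\<bar>" by (metis abs_ge_minus_self abs_mult)
    also have "\<dots> \<le> (c - d) * \<bar>t\<bar>" using Im[OF that] by (intro mult_right_mono) auto
    finally have "norm (?f z t) \<le> exp ((c - d) * \<bar>t\<bar>) * (C * exp (- c * \<bar>t\<bar>))"
      using bound[of t] unfolding norm_mult by (intro mult_mono) auto
    also have "\<dots> = C * exp (- d * \<bar>t\<bar>)"
      by (simp add: exp_add[symmetric] algebra_simps)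
    finally show ?thesis .
  qed
  define T where "T n = (\<integral>t. C * exp (- d * \<bar>t\<bar>) * indicator (- {- real n..real n}) t \<partial>lborel)" for n
  have iw: "integrable lborel (\<lambda>t. C * exp (- d * \<bar>t\<bar>))"
    using integrable_exp_minus_abs[OF d] by simp
  have iwn: "integrable lborel (\<lambda>t. C * exp (- d * \<bar>t\<bar>) * indicator (- {- real n..real n}) t)" for n
    by (rule Bochner_Integration.integrable_bound[OF iw]) (auto simp: indicator_def C0)
  have T0: "T \<longlonglongrightarrow> 0"
  proof -
    have "T \<longlonglongrightarrow> (\<integral>t. 0 \<partial>(lborel :: real measure))"
      unfolding T_def
    proof (rule integral_dominated_convergence[OF _ _ iw])
      have "(\<lambda>n. C * exp (- d * \<bar>t\<bar>) * indicator (- {- real n..real n}) t) \<longlonglongrightarrow> 0" for t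
      proof (rule tendsto_eventually)
        obtain n0 where "\<bar>t\<bar> \<le> real n0" using real_arch_simple by blast
        then show "\<forall>\<^sub>F n in sequentially. C * exp (- d * \<bar>t\<bar>) * indicator (- {- real n..real n}) t = 0"
          by (intro eventually_sequentiallyI[of n0]) (auto simp: indicator_def)
      qed
      then show "AE t in lborel. (\<lambda>n. C * exp (- d * \<bar>t\<bar>) * indicator (- {- real n..real n}) t) \<longlonglongrightarrow> 0"
        by simp
    qed (auto simp: indicator_def C0)
    then show ?thesis by simp
  qed
  have lim: "uniform_limit (cball z0 d) (\<lambda>n z. integral (cbox (- real n) (real n)) (?f z))
      (\<lambda>z. \<integral>t. ?f z t \<partial>lborel) sequentially"
  proof (rule uniform_limitI)
    fix e :: real assume "e > 0"
    have le: "dist (integral (cbox (- real n) (real n)) (?f z)) (\<integral>t. ?f z t \<partial>lborel) \<le> T n"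
      if z: "z \<in> cball z0 d" for n z
    proof -
      have cf: "continuous_on UNIV (?f z)" by (intro continuous_intros cont)
      have if1: "integrable lborel (?f z)"
        by (rule Bochner_Integration.integrable_bound[OF iw])
          (use fb[OF z] C0 borel_measurable_continuous_onI[OF cf] in auto)
      have if2: "set_integrable lborel {- real n..real n} (?f z)"
        by (rule borel_integrable_atLeastAtMost') (rule continuous_on_subset[OF cf], simp)
      have "integral (cbox (- real n) (real n)) (?f z) = (\<integral>t. indicator {- real n..real n} t *\<^sub>R ?f z t \<partial>lborel)"
        using set_borel_integral_eq_integral(2)[OF if2] by (simp add: set_lebesgue_integral_def)
      then have "(\<integral>t. ?f z t \<partial>lborel) - integral (cbox (- real n) (real n)) (?f z)
          = (\<integral>t. ?f z t - indicator {- real n..real n} t *\<^sub>R ?f z t \<partial>lborel)"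
        using if1 if2 by (simp add: set_integrable_def)
      also have "norm \<dots> \<le> T n"
        unfolding T_def
      proof (rule Bochner_Integration.integral_norm_bound_integral)
        show "integrable lborel (\<lambda>t. ?f z t - indicator {- real n..real n} t *\<^sub>R ?f z t)"
          using if1 if2 by (simp add: set_integrable_def)
        show "norm (?f z t - indicator {- real n..real n} t *\<^sub>R ?f z t)
            \<le> C * exp (- d * \<bar>t\<bar>) * indicator (- {- real n..real n}) t" for t
          using fb[OF z, of t] by (auto simp: indicator_def)
      qed (rule iwn)
      finally show ?thesis by (simp add: dist_norm norm_minus_commute)
    qed
    have "\<forall>\<^sub>F n in sequentially. T n < e" using T0 \<open>e > 0\<close> by (rule order_tendstoD)
    then show "\<forall>\<^sub>F n in sequentially. \<forall>z\<in>cball z0 d.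
        dist (integral (cbox (- real n) (real n)) (?f z)) (\<integral>t. ?f z t \<partial>lborel) < e"
      by (rule eventually_mono) (blast intro: le_less_trans[OF le])
  qed
  show "\<exists>d>0. cball z0 d \<subseteq> ?S \<and> uniform_limit (cball z0 d)
      (\<lambda>n z. integral (cbox (- real n) (real n)) (?f z)) (\<lambda>z. \<integral>t. ?f z t \<partial>lborel) sequentially"
    using d sub lim by blast
qed

text \<open>Analytic continuation: the transform is holomorphic on a strip around the real axis and vanishes
on a real interval, hence on the whole strip.\<close>

lemma eq_0_if_fourier_eq_0_near_0:
  fixes G :: "real \<Rightarrow> complex"
  assumes cont: "continuous_on UNIV G" and bound: "\<And>t. norm (G t) \<le> C * exp (- c * \<bar>t\<bar>)" and "c > 0"
    and zero: "\<And>\<tau>. \<bar>\<tau>\<bar> < \<rho> \<Longrightarrow> (\<integral>t. iexp (\<tau> * t) * G t \<partial>lborel) = 0" and "\<rho> > 0"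
  shows "G t = 0"
proof (rule eq_0_if_fourier_eq_0[OF cont])
  have iw: "integrable lborel (\<lambda>t. C * exp (- c * \<bar>t\<bar>))"
    using integrable_exp_minus_abs[OF \<open>c > 0\<close>] by simp
  show "integrable lborel G"
    by (rule Bochner_Integration.integrable_bound[OF iw])
      (use borel_measurable_continuous_onI[OF cont] order_trans[OF bound abs_ge_self] in auto)
  let ?F = "\<lambda>z. \<integral>t. exp (\<i> * z * of_real t) * G t \<partial>lborel"
  let ?S = "{z. \<bar>Im z\<bar> < c}"
  have open_S: "open ?S" by (intro open_Collect_less continuous_intros)
  have "?S = {z. Im z < c} \<inter> {z. Im z > - c}" by auto
  then have "convex ?S"
    by (simp add: convex_Int convex_halfspace_Im_lt convex_halfspace_Im_gt)
  then have conn: "connected ?S" by (rule convex_connected)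
  show "(\<integral>t. iexp (\<tau> * t) * G t \<partial>lborel) = 0" for \<tau>
  proof -
    have "?F (of_real \<tau>) = 0"
    proof (rule analytic_continuation[of ?F ?S "of_real ` {-\<rho><..<\<rho>}" 0])
      show "?F holomorphic_on ?S" by (rule fourier_holomorphic_on_strip[OF cont bound])
      show "0 islimpt complex_of_real ` {-\<rho><..<\<rho>}"
        unfolding islimpt_approachable
      proof (intro allI impI)
        fix e :: real assume "e > 0"
        then show "\<exists>x'\<in>complex_of_real ` {-\<rho><..<\<rho>}. x' \<noteq> 0 \<and> dist x' 0 < e"
          using \<open>\<rho> > 0\<close> by (intro bexI[of _ "of_real (min \<rho> e / 2)"] imageI) (auto simp: dist_norm norm_divide min_def)
      qed
      fix z :: complex assume "z \<in> of_real ` {-\<rho><..<\<rho>}"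
      then obtain \<sigma> where \<sigma>: "z = of_real \<sigma>" "\<bar>\<sigma>\<bar> < \<rho>" by auto
      from zero[OF \<sigma>(2)] show "?F z = 0" by (simp add: \<sigma>(1) mult.assoc)
    qed (use \<open>c > 0\<close> open_S conn in auto)
    then show ?thesis by (simp add: mult.assoc)
  qed
qed

text \<open>Call \<open>N\<close> the functions supported in the ball whose transform vanishes. The real
functions that multiply \<open>N\<close> into itself form an algebra. It contains the constants and all
functions \<open>cos (\<eta> \<bullet> x)\<close> and \<open>sin (\<eta> \<bullet> x)\<close>, because
multiplication by a character shifts the frequency. By Stone and Weierstrass these multipliers are uniformly
dense on the ball, so \<open>f\<close> has zero integral against every continuous function, in particular
against its own real and imaginary parts. Frequency 0 is covered by continuity of the transform.\<close>

lemma eq_0_if_compact_fourier_eq_0: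
  fixes f :: "'a::euclidean_space \<Rightarrow> complex"
  assumes cont: "continuous_on UNIV f" and supp: "\<And>x. norm x > R \<Longrightarrow> f x = 0"
    and zero: "\<And>\<xi>. \<xi> \<noteq> 0 \<Longrightarrow> (\<integral>x. iexp (\<xi> \<bullet> x) * f x \<partial>lborel) = 0"
  shows "f x = 0"
proof -
  define V where "V = {g :: 'a \<Rightarrow> complex. continuous_on UNIV g \<and> (\<forall>x. norm x > R \<longrightarrow> g x = 0)}"
  have int: "integrable lborel g" if "g \<in> V" for g
  proof -
    have "continuous_on (cball 0 R) g" using that by (auto simp: V_def intro: continuous_on_subset)
    then have "integrable lborel (\<lambda>x. indicator (cball 0 R) x *\<^sub>R g x)"
      by (rule borel_integrable_compact[OF compact_cball])
    moreover have "(\<lambda>x. indicator (cball 0 R) x *\<^sub>R g x) = g"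
      using that by (auto simp: V_def indicator_def fun_eq_iff)
    ultimately show ?thesis by simp
  qed
  have mult: "(\<lambda>x. u x * g x) \<in> V" if "g \<in> V" "continuous_on UNIV u" for u g
    using that by (auto simp: V_def intro: continuous_intros)
  have fV: "f \<in> V" using cont supp by (simp add: V_def)
  have zero': "(\<integral>x. iexp (\<xi> \<bullet> x) * f x \<partial>lborel) = 0" for \<xi>
  proof (cases "\<xi> = 0")
    case True
    obtain b :: 'a where b: "b \<in> Basis" using nonempty_Basis by blast
    have "(\<lambda>n. \<integral>x. iexp ((inverse (real (Suc n)) *\<^sub>R b) \<bullet> x) * f x \<partial>lborel) \<longlonglongrightarrow> (\<integral>x. iexp (0 \<bullet> x) * f x \<partial>lborel)"
    proof (rule integral_dominated_convergence)
      show "AE x in lborel. (\<lambda>n. iexp ((inverse (real (Suc n)) *\<^sub>R b) \<bullet> x) * f x) \<longlonglongrightarrow> iexp (0 \<bullet> x) * f x"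
      proof (rule AE_I2)
        fix x
        have "(\<lambda>n. iexp ((inverse (real (Suc n)) *\<^sub>R b) \<bullet> x) * f x) \<longlonglongrightarrow> iexp ((0 *\<^sub>R b) \<bullet> x) * f x"
          by (intro tendsto_intros LIMSEQ_inverse_real_of_nat)
        then show "(\<lambda>n. iexp ((inverse (real (Suc n)) *\<^sub>R b) \<bullet> x) * f x) \<longlonglongrightarrow> iexp (0 \<bullet> x) * f x" by simp
      qed
      show "integrable lborel (\<lambda>x. norm (f x))" using int[OF fV] by simp
    qed (use borel_measurable_continuous_onI[OF cont] in \<open>auto simp: norm_mult\<close>)
    moreover have "(\<integral>x. iexp ((inverse (real (Suc n)) *\<^sub>R b) \<bullet> x) * f x \<partial>lborel) = 0" for n
      by (rule zero) (use b in auto)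
    ultimately show ?thesis using True by (simp add: LIMSEQ_const_iff)
  qed (rule zero)
  define N where "N = {g \<in> V. \<forall>\<xi>. (\<integral>x. iexp (\<xi> \<bullet> x) * g x \<partial>lborel) = 0}"
  define P where "P u \<longleftrightarrow> continuous_on UNIV u \<and> (\<forall>g\<in>N. (\<lambda>x. of_real (u x) * g x) \<in> N)" for u :: "'a \<Rightarrow> real"
  have cexp: "continuous_on UNIV (\<lambda>x. iexp (\<xi> \<bullet> x))" for \<xi> :: 'a
    by (intro continuous_intros)
  have N_add: "(\<lambda>x. g x + h x) \<in> N" if "g \<in> N" "h \<in> N" for g h
    using that int[OF mult[OF _ cexp]]
    by (auto simp: N_def V_def distrib_left intro!: continuous_intros)
  have N_scale: "(\<lambda>x. z * g x) \<in> N" if "g \<in> N" for g z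
  proof -
    have "(\<integral>x. iexp (\<xi> \<bullet> x) * (z * g x) \<partial>lborel) = (\<integral>x. z * (iexp (\<xi> \<bullet> x) * g x) \<partial>lborel)" for \<xi>
      by (simp add: mult.left_commute)
    then show ?thesis using that by (auto simp: N_def V_def intro!: continuous_intros)
  qed
  have N_exp: "(\<lambda>x. iexp (\<eta> \<bullet> x) * g x) \<in> N" if "g \<in> N" for g \<eta>
  proof -
    have "(\<integral>x. iexp (\<xi> \<bullet> x) * (iexp (\<eta> \<bullet> x) * g x) \<partial>lborel) = (\<integral>x. iexp ((\<xi> + \<eta>) \<bullet> x) * g x \<partial>lborel)" for \<xi>
      by (simp add: inner_add_left distrib_left exp_add mult.assoc)
    then show ?thesis using that mult[OF _ cexp] by (auto simp: N_def)
  qed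
  have P_cos: "P (\<lambda>x. cos (\<eta> \<bullet> x))" for \<eta>
    unfolding P_def
  proof (intro conjI ballI continuous_intros)
    fix g assume "g \<in> N"
    then have "(\<lambda>x. 1/2 * (iexp (\<eta> \<bullet> x) * g x + iexp ((- \<eta>) \<bullet> x) * g x)) \<in> N"
      by (intro N_scale N_add N_exp)
    moreover have "1/2 * (iexp (\<eta> \<bullet> x) * g x + iexp ((- \<eta>) \<bullet> x) * g x) = of_real (cos (\<eta> \<bullet> x)) * g x" for x
      by (simp add: cos_of_real[symmetric] cos_exp_eq field_simps)
    ultimately show "(\<lambda>x. of_real (cos (\<eta> \<bullet> x)) * g x) \<in> N" by simp
  qed
  have P_sin: "P (\<lambda>x. sin (\<eta> \<bullet> x))" for \<eta>
    unfolding P_def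
  proof (intro conjI ballI continuous_intros)
    fix g assume "g \<in> N"
    then have "(\<lambda>x. 1/(2*\<i>) * (iexp (\<eta> \<bullet> x) * g x + (-1) * (iexp ((- \<eta>) \<bullet> x) * g x))) \<in> N"
      by (intro N_scale N_add N_exp)
    moreover have "1/(2*\<i>) * (iexp (\<eta> \<bullet> x) * g x + (-1) * (iexp ((- \<eta>) \<bullet> x) * g x)) = of_real (sin (\<eta> \<bullet> x)) * g x" for x
      by (simp add: sin_of_real[symmetric] sin_exp_eq field_simps)
    ultimately show "(\<lambda>x. of_real (sin (\<eta> \<bullet> x)) * g x) \<in> N" by simp
  qed
  have fN: "f \<in> N" using fV zero' by (simp add: N_def)
  have zero_q: "(\<integral>x. of_real (q x) * f x \<partial>lborel) = 0" if q: "continuous_on UNIV q" for q :: "'a \<Rightarrow> real"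
  proof -
    define M where "M = (\<integral>x. norm (f x) \<partial>lborel)"
    have le: "norm (\<integral>x. of_real (q x) * f x \<partial>lborel) \<le> e * M" if "e > 0" for e
    proof -
      have "\<exists>u. P u \<and> (\<forall>x\<in>cball 0 R. \<bar>q x - u x\<bar> < e)"
      proof (rule Stone_Weierstrass_HOL)
        show "P (\<lambda>x. c)" for c using N_scale by (simp add: P_def)
        show "continuous_on (cball 0 R) u" if "P u" for u
          using that by (auto simp: P_def intro: continuous_on_subset)
        show "P (\<lambda>x. u x + v x)" if "P u \<and> P v" for u v
          using that N_add by (auto simp: P_def distrib_right intro: continuous_intros)
        show "P (\<lambda>x. u x * v x)" if "P u \<and> P v" for u v
          using that by (auto simp: P_def mult.assoc intro: continuous_intros)
        show "\<exists>u. P u \<and> u x \<noteq> u y" if "x \<in> cball 0 R \<and> y \<in> cball 0 R \<and> x \<noteq> y" for x y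
        proof -
          \<comment> \<open>With this frequency the phases at \<open>x\<close> and \<open>y\<close> differ by \<open>\<pi>\<close>, so both cosine and sine change
            sign from \<open>y\<close> to \<open>x\<close>, and they cannot both vanish.\<close>
          define \<eta> where "\<eta> = (pi / ((x - y) \<bullet> (x - y))) *\<^sub>R (x - y)"
          have "\<eta> \<bullet> (x - y) = pi" using that by (simp add: \<eta>_def)
          then have *: "\<eta> \<bullet> x = \<eta> \<bullet> y + pi" by (simp add: inner_diff_right)
          show ?thesis
          proof (cases "cos (\<eta> \<bullet> y) = 0")
            case True
            then have "sin (\<eta> \<bullet> y) \<noteq> 0" using sin_zero_norm_cos_one by fastforce
            then have "sin (\<eta> \<bullet> x) \<noteq> sin (\<eta> \<bullet> y)" by (simp add: *)
            then show ?thesis using P_sin by blast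
          next
            case False
            then have "cos (\<eta> \<bullet> x) \<noteq> cos (\<eta> \<bullet> y)" by (simp add: *)
            then show ?thesis using P_cos by blast
          qed
        qed
      qed (use q \<open>e > 0\<close> in \<open>auto intro: continuous_on_subset\<close>)
      then obtain u where u: "P u" "\<And>x. norm x \<le> R \<Longrightarrow> \<bar>q x - u x\<bar> < e" by auto
      have cu: "continuous_on UNIV u" using u(1) by (simp add: P_def)
      have "(\<lambda>x. of_real (u x) * f x) \<in> N" using u(1) fN by (simp add: P_def)
      then have "\<forall>\<xi>. (\<integral>x. iexp (\<xi> \<bullet> x) * (of_real (u x) * f x) \<partial>lborel) = 0" by (simp add: N_def)
      from spec[OF this, of 0] have u0: "(\<integral>x. of_real (u x) * f x \<partial>lborel) = 0" by simp
      have iu: "integrable lborel (\<lambda>x. of_real (u x) * f x)" "integrable lborel (\<lambda>x. of_real (q x) * f x)"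
        by (intro int mult fV continuous_on_of_real cu q)+
      have "norm (\<integral>x. of_real (q x) * f x \<partial>lborel) = norm (\<integral>x. of_real (q x) * f x - of_real (u x) * f x \<partial>lborel)"
        using iu u0 by simp
      also have "\<dots> \<le> (\<integral>x. e * norm (f x) \<partial>lborel)"
      proof (rule Bochner_Integration.integral_norm_bound_integral)
        show "norm (of_real (q x) * f x - of_real (u x) * f x) \<le> e * norm (f x)" for x
        proof (cases "norm x > R")
          case False
          have "norm (of_real (q x) * f x - of_real (u x) * f x) = \<bar>q x - u x\<bar> * norm (f x)"
            by (simp only: left_diff_distrib[symmetric] norm_mult of_real_diff[symmetric] norm_of_real real_norm_def)
          also have "\<dots> \<le> e * norm (f x)" using u(2)[of x] False by (intro mult_right_mono) auto
          finally show ?thesis .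
        qed (simp add: supp)
      qed (use iu int[OF fV] in auto)
      finally show ?thesis by (simp add: M_def)
    qed
    show ?thesis
    proof (rule ccontr)
      assume "\<not> ?thesis"
      then have n: "norm (\<integral>x. of_real (q x) * f x \<partial>lborel) > 0" (is "?n > 0") by simp
      have M0: "M \<ge> 0" by (simp add: M_def)
      have "?n \<le> ?n / (2 * (M + 1)) * M" by (rule le) (use n M0 in auto)
      also have "\<dots> = ?n * (M / (2 * (M + 1)))" by simp
      also have "\<dots> < ?n * 1" using n M0 by (intro mult_strict_left_mono) auto
      finally show False by simp
    qed
  qed
  \<comment> \<open>The real part of \<open>q (q + i r)\<close> is \<open>q^2\<close>. This is used for \<open>f = Re f + i Im f\<close> and for
    \<open>- i f = Im f - i Re f\<close>.\<close>
  have sq: "q x = 0" if q: "continuous_on UNIV q" "\<And>x. norm x > R \<Longrightarrow> q x = 0"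
    and 0: "Re (\<integral>x. of_real (q x) * (of_real (q x) + \<i> * of_real (r x)) \<partial>lborel) = 0" and r: "continuous_on UNIV r"
    for q r :: "'a \<Rightarrow> real" and x
  proof -
    have i: "integrable lborel (\<lambda>x. complex_of_real (q x) * (of_real (q x) + \<i> * of_real (r x)))"
      by (rule int) (use q r in \<open>auto simp: V_def intro!: continuous_intros\<close>)
    have "q x * q x = 0"
    proof (rule continuous_integral_zero_imp_zero[of "\<lambda>x. q x * q x"])
      show "continuous_on UNIV (\<lambda>x. q x * q x)" by (intro continuous_intros q)
      have "(\<lambda>x. Re (complex_of_real (q x) * (of_real (q x) + \<i> * of_real (r x)))) = (\<lambda>x. q x * q x)" by simp
      then show "integrable lborel (\<lambda>x. q x * q x)" "(\<integral>x. q x * q x \<partial>lborel) = 0"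
        using integrable_Re[OF i] integral_Re[OF i] 0 by auto
    qed simp
    then show ?thesis by simp
  qed
  have "Re (f x) = 0"
  proof (rule sq[of "\<lambda>x. Re (f x)" "\<lambda>x. Im (f x)"])
    have "(\<lambda>x. complex_of_real (Re (f x)) * (of_real (Re (f x)) + \<i> * of_real (Im (f x)))) = (\<lambda>x. of_real (Re (f x)) * f x)"
      by (simp add: complex_eq[symmetric])
    then show "Re (\<integral>x. complex_of_real (Re (f x)) * (of_real (Re (f x)) + \<i> * of_real (Im (f x))) \<partial>lborel) = 0"
      using zero_q[of "\<lambda>x. Re (f x)"] cont by (simp add: continuous_on_Re)
  qed (use supp in \<open>auto intro!: continuous_intros cont\<close>)
  moreover have "Im (f x) = 0"
  proof (rule sq[of "\<lambda>x. Im (f x)" "\<lambda>x. - Re (f x)"])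
    have "(\<lambda>x. complex_of_real (Im (f x)) * (of_real (Im (f x)) + \<i> * of_real (- Re (f x)))) = (\<lambda>x. - \<i> * (of_real (Im (f x)) * f x))"
      by (auto simp: complex_eq_iff)
    then show "Re (\<integral>x. complex_of_real (Im (f x)) * (of_real (Im (f x)) + \<i> * of_real (- Re (f x))) \<partial>lborel) = 0"
      using zero_q[of "\<lambda>x. Im (f x)"] cont by (simp add: continuous_on_Im)
  qed (use supp in \<open>auto intro!: continuous_intros cont\<close>)
  ultimately show ?thesis by (simp add: complex_eq_iff)
qed

text \<open>Fix \<open>\<xi> \<noteq> 0\<close> and let \<open>G(t)\<close> be the partial Fourier transform
of \<open>g\<close> in space. By Fubini the transform of \<open>G\<close> vanishes for \<open>|\<tau>| <
|\<xi>|\<close>, and it is holomorphic near the real axis, so \<open>G = 0\<close>. Thus every slice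
\<open>g(t, \<cdot>)\<close> has vanishing transform away from the origin.\<close>

lemma eq_0_if_fourier_eq_0_spacelike:
  fixes g :: "real \<times> 'a::euclidean_space \<Rightarrow> complex"
  assumes cont: "continuous_on UNIV g" and decay: "exp_decay c g" "c > 0"
    and supp: "\<And>p. norm (snd p) > R \<Longrightarrow> g p = 0"
    and zero: "\<And>\<zeta>. \<bar>fst \<zeta>\<bar> < norm (snd \<zeta>) \<Longrightarrow> (\<integral>p. iexp (\<zeta> \<bullet> p) * g p \<partial>lborel) = 0"
  shows "g p = 0"
proof -
  obtain C where C: "C > 0" "\<And>p. norm (g p) \<le> C * exp (- c * \<bar>fst p\<bar>)"
    using exp_decayD[OF decay(1)] by blast
  have cg: "continuous_on UNIV (\<lambda>x. g (t, x))" for t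
    by (rule continuous_on_compose2[OF cont]) (auto intro!: continuous_intros)
  have ind: "integrable lborel (indicator (cball 0 R) :: 'a \<Rightarrow> real)"
    using emeasure_lborel_cball_finite[of "0::'a" R] by (intro integrable_real_indicator) (auto simp: top.not_eq_extremum)
  have "g (t, x) = 0" for t x
  proof (rule eq_0_if_compact_fourier_eq_0[where f = "\<lambda>x. g (t, x)" and R = R])
    fix \<xi> :: 'a assume "\<xi> \<noteq> 0"
    define h where "h s x = iexp (\<xi> \<bullet> x) * g (s, x)" for s x
    define G where "G s = (\<integral>x. h s x \<partial>lborel)" for s
    have ch: "continuous_on UNIV (h s)" for s unfolding h_def by (intro continuous_intros cg)
    have hb: "norm (h s x) \<le> C * exp (- c * \<bar>s\<bar>) * indicator (cball 0 R) x" for s x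
      using C(2)[of "(s, x)"] C(1) supp[of "(s, x)"] by (auto simp: h_def norm_mult indicator_def)
    have mh: "h s \<in> borel_measurable lborel" for s
      using borel_measurable_continuous_onI[OF ch] by simp
    have "G t = 0"
    proof (rule eq_0_if_fourier_eq_0_near_0)
      show "continuous_on UNIV G"
        unfolding continuous_on_sequentially
      proof (intro allI ballI impI, elim conjE)
        fix s0 and s :: "nat \<Rightarrow> real" assume s: "s \<longlonglongrightarrow> s0"
        have "(\<lambda>n. G (s n)) \<longlonglongrightarrow> G s0"
          unfolding G_def
        proof (rule integral_dominated_convergence)
          show "integrable lborel (\<lambda>x. C * indicator (cball 0 R :: 'a set) x)" using ind by simp
          have "(\<lambda>n. h (s n) x) \<longlonglongrightarrow> h s0 x" for x
          proof -
            have "(\<lambda>n. g (s n, x)) \<longlonglongrightarrow> g (s0, x)"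
              by (rule continuous_on_tendsto_compose[OF cont]) (auto intro!: tendsto_intros s)
            then show ?thesis unfolding h_def by (intro tendsto_intros)
          qed
          then show "AE x in lborel. (\<lambda>n. h (s n) x) \<longlonglongrightarrow> h s0 x" by simp
          have "norm (h s x) \<le> C * indicator (cball 0 R) x" for s x
            by (rule order_trans[OF hb]) (use C(1) decay(2) in \<open>auto simp: indicator_def\<close>)
          then show "AE x in lborel. norm (h (s n) x) \<le> C * indicator (cball 0 R) x" for n by simp
        qed (rule mh)+
        then show "(G \<circ> s) \<longlonglongrightarrow> G s0" by (simp add: o_def)
      qed
      show "norm (G s) \<le> (C * measure lborel (cball 0 R :: 'a set)) * exp (- c * \<bar>s\<bar>)" for s
      proof -
        have "norm (G s) \<le> (\<integral>x. C * exp (- c * \<bar>s\<bar>) * indicator (cball 0 R :: 'a set) x \<partial>lborel)"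
          unfolding G_def
        proof (rule Bochner_Integration.integral_norm_bound_integral[OF _ _ hb])
          show i: "integrable lborel (\<lambda>x. C * exp (- c * \<bar>s\<bar>) * indicator (cball 0 R :: 'a set) x)"
            using ind by simp
          show "integrable lborel (h s)"
            by (rule Bochner_Integration.integrable_bound[OF i mh]) (intro AE_I2 order_trans[OF hb], simp)
        qed
        then show ?thesis by (simp add: mult.commute mult.left_commute)
      qed
      show "norm \<xi> > 0" using \<open>\<xi> \<noteq> 0\<close> by simp
      fix \<tau> assume "\<bar>\<tau>\<bar> < norm \<xi>"
      have cE: "continuous_on UNIV (\<lambda>p. iexp ((\<tau>, \<xi>) \<bullet> p) * g p)" by (intro continuous_intros cont)
      have "integrable lborel (\<lambda>p. iexp ((\<tau>, \<xi>) \<bullet> p) * g p)"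
        by (rule integrable_if_exp_decay[OF cE exp_decay_iexp_mult[OF decay(1)] decay(2), where R = R]) (simp add: supp)
      then have i: "integrable (lborel \<Otimes>\<^sub>M lborel) (\<lambda>p. iexp ((\<tau>, \<xi>) \<bullet> p) * g p)" by (simp add: lborel_prod)
      have "(\<integral>s. iexp (\<tau> * s) * G s \<partial>lborel) = (\<integral>s. \<integral>x. iexp ((\<tau>, \<xi>) \<bullet> (s, x)) * g (s, x) \<partial>lborel \<partial>lborel)"
        unfolding G_def h_def integral_mult_right_zero[symmetric]
        by (simp add: exp_add distrib_left mult.assoc)
      also have "\<dots> = (\<integral>p. iexp ((\<tau>, \<xi>) \<bullet> p) * g p \<partial>lborel)"
        using lborel_pair.integral_fst'[OF i] by (simp add: lborel_prod)
      also have "\<dots> = 0" by (rule zero) (use \<open>\<bar>\<tau>\<bar> < norm \<xi>\<close> in simp)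
      finally show "(\<integral>s. iexp (\<tau> * s) * G s \<partial>lborel) = 0" .
    qed (rule decay)
    then show "(\<integral>x. iexp (\<xi> \<bullet> x) * g (t, x) \<partial>lborel) = 0" by (simp add: G_def h_def)
  qed (use cg supp in auto)
  then show ?thesis by (cases p) simp
qed

section \<open>Closedness of forms with vanishing light ray transform\<close>

text \<open>For \<open>\<zeta> = (\<tau>, \<xi>)\<close> let \<open>\<omega>\<^sub>0\<close> be the multiple
of \<open>\<xi>\<close> with \<open>\<omega>\<^sub>0 \<bullet> \<xi> = - \<tau>\<close>; it lies inside the
unit ball because \<open>\<zeta>\<close> is spacelike. For a unit vector \<open>\<eta>\<close> orthogonal to
\<open>\<xi>\<close> the two points \<open>\<omega>\<^sub>0 \<plusminus> \<rho> \<eta>\<close> lie on the unit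
sphere, and comparing \<open>L\<close> on the two resulting light directions kills both \<open>(0,
\<eta>)\<close> and \<open>(1, \<omega>\<^sub>0)\<close>. These vectors span the orthogonal complement of
\<open>\<zeta>\<close>; a vector \<open>\<eta>\<close> exists since the dimension is at least 2.\<close>

lemma linear_form_eq_0_on_orthogonal:
  fixes L :: "real \<times> 'a::euclidean_space \<Rightarrow> 'b::real_vector"
  assumes L: "linear L" and dim: "DIM('a) \<ge> 2"
    and null: "\<And>\<omega>. norm \<omega> = 1 \<Longrightarrow> \<zeta> \<bullet> (1, \<omega>) = 0 \<Longrightarrow> L (1, \<omega>) = 0"
    and spacelike: "\<bar>fst \<zeta>\<bar> < norm (snd \<zeta>)" and orth: "\<zeta> \<bullet> w = 0"
  shows "L w = 0"
proof -
  define \<tau> \<xi> where "\<tau> = fst \<zeta>" and "\<xi> = snd \<zeta>"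
  have \<zeta>: "\<zeta> = (\<tau>, \<xi>)" by (simp add: \<tau>_def \<xi>_def)
  have lt: "\<bar>\<tau>\<bar> < norm \<xi>" using spacelike by (simp add: \<tau>_def \<xi>_def)
  define \<omega>0 where "\<omega>0 = (- \<tau> / (\<xi> \<bullet> \<xi>)) *\<^sub>R \<xi>"
  have \<xi>0: "\<xi> \<noteq> 0" using lt by auto
  have \<omega>0: "\<omega>0 \<bullet> \<xi> = - \<tau>" using \<xi>0 by (simp add: \<omega>0_def)
  have n\<omega>0: "norm \<omega>0 < 1"
  proof -
    have "norm \<omega>0 = \<bar>\<tau>\<bar> / norm \<xi>"
      using \<xi>0 by (simp add: \<omega>0_def dot_square_norm power2_eq_square)
    then show ?thesis using lt \<xi>0 by simp
  qed
  define \<rho> where "\<rho> = sqrt (1 - (norm \<omega>0)\<^sup>2)"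
  have "(norm \<omega>0)\<^sup>2 < 1" using n\<omega>0 by (simp add: power_less_one_iff abs_square_less_1)
  then have \<rho>: "\<rho> > 0" "\<rho>\<^sup>2 = 1 - (norm \<omega>0)\<^sup>2" by (auto simp: \<rho>_def)
  have pair: "L (0, \<eta>) = 0 \<and> L (1, \<omega>0) = 0" if \<eta>: "norm \<eta> = 1" "\<eta> \<bullet> \<xi> = 0" for \<eta>
  proof -
    have van: "L (1, \<omega>0 + r *\<^sub>R \<eta>) = 0" if r: "r\<^sup>2 = \<rho>\<^sup>2" for r
    proof (rule null)
      have "\<omega>0 \<bullet> \<eta> = 0" using \<eta> by (simp add: \<omega>0_def inner_commute)
      then have "(norm (\<omega>0 + r *\<^sub>R \<eta>))\<^sup>2 = (norm \<omega>0)\<^sup>2 + r\<^sup>2 * (norm \<eta>)\<^sup>2"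
        unfolding power2_norm_eq_inner
        by (simp add: inner_add_left inner_add_right inner_commute power2_eq_square)
      then have "(norm (\<omega>0 + r *\<^sub>R \<eta>))\<^sup>2 = 1" using r \<rho> \<eta> by simp
      then show "norm (\<omega>0 + r *\<^sub>R \<eta>) = 1" by (simp add: power2_eq_1_iff) (smt (verit) norm_ge_zero)
      show "\<zeta> \<bullet> (1, \<omega>0 + r *\<^sub>R \<eta>) = 0"
        using \<omega>0 \<eta> by (simp add: \<zeta> inner_add_right inner_commute)
    qed
    have p: "L (1, \<omega>0 + r *\<^sub>R \<eta>) = L (1, \<omega>0) + r *\<^sub>R L (0, \<eta>)" for r
    proof -
      have "(1 :: real, \<omega>0 + r *\<^sub>R \<eta>) = (1, \<omega>0) + r *\<^sub>R (0, \<eta>)" by simp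
      then show ?thesis by (simp only: linear_add[OF L] linear_scale[OF L])
    qed
    have "(2 * \<rho>) *\<^sub>R L (0, \<eta>) = (L (1, \<omega>0) + \<rho> *\<^sub>R L (0, \<eta>)) - (L (1, \<omega>0) + (- \<rho>) *\<^sub>R L (0, \<eta>))"
      by (simp only: mult_2 scaleR_add_left) simp
    also have "\<dots> = L (1, \<omega>0 + \<rho> *\<^sub>R \<eta>) - L (1, \<omega>0 + (- \<rho>) *\<^sub>R \<eta>)" by (simp only: p)
    also have "\<dots> = 0" using van[of \<rho>] van[of "- \<rho>"] by simp
    finally have "(2 * \<rho>) *\<^sub>R L (0, \<eta>) = 0" .
    then have "L (0, \<eta>) = 0" using \<rho> by simp
    then show ?thesis using van[of \<rho>] p[of \<rho>] by simp
  qed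
  have pair0: "L (0, \<eta>) = 0" if \<eta>: "\<eta> \<bullet> \<xi> = 0" for \<eta>
  proof (cases "\<eta> = 0")
    case True
    then show ?thesis using linear_0[OF L] by (simp add: zero_prod_def)
  next
    case False
    have "(0 :: real, \<eta>) = norm \<eta> *\<^sub>R (0, \<eta> /\<^sub>R norm \<eta>)" using False by simp
    then have "L (0, \<eta>) = norm \<eta> *\<^sub>R L (0, \<eta> /\<^sub>R norm \<eta>)" by (metis linear_scale[OF L])
    then show ?thesis using pair[of "\<eta> /\<^sub>R norm \<eta>"] False \<eta> by simp
  qed
  obtain \<nu> where "\<nu> \<noteq> 0" "\<nu> \<bullet> \<xi> = 0"
    using orthogonal_to_vector_exists[OF dim, of \<xi>] by (metis orthogonal_def inner_commute)
  then have L0: "L (1, \<omega>0) = 0" using pair[of "\<nu> /\<^sub>R norm \<nu>"] by simp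
  obtain a y where w: "w = (a, y)" by (cases w)
  have "(y - a *\<^sub>R \<omega>0) \<bullet> \<xi> = 0"
  proof -
    have "y \<bullet> \<xi> = - (\<tau> * a)" using orth by (simp add: w \<zeta> inner_commute)
    then show ?thesis by (simp add: inner_diff_left \<omega>0)
  qed
  then have "L (0, y - a *\<^sub>R \<omega>0) = 0" by (rule pair0)
  moreover have "w = a *\<^sub>R (1, \<omega>0) + (0, y - a *\<^sub>R \<omega>0)" by (simp add: w)
  ultimately show ?thesis by (simp only: linear_add[OF L] linear_scale[OF L] L0) simp
qed

text \<open>The function \<open>\<alpha>' p u v\<close> is the derivative of \<open>\<alpha>(\<cdot>)
v\<close> in direction \<open>u\<close>, so that \<open>d\<alpha>(u, v)\<close> is its antisymmetrisation. The
transform of \<open>d\<alpha>(u, v)\<close> is, up to a factor, the transform of \<open>\<alpha>\<close>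
paired with \<open>(\<zeta> \<bullet> u) v - (\<zeta> \<bullet> v) u\<close>, a vector orthogonal to
\<open>\<zeta>\<close>.\<close>

lemma closed_if_light_ray_transform_eq_0:
  fixes \<alpha> :: "real \<times> 'a::euclidean_space \<Rightarrow> real \<times> 'a \<Rightarrow> complex"
    and \<alpha>' :: "real \<times> 'a \<Rightarrow> real \<times> 'a \<Rightarrow> real \<times> 'a \<Rightarrow> complex"
  assumes dim: "DIM('a) \<ge> 2"
    and lin: "\<And>p. linear (\<alpha> p)"
    and d: "\<And>p v. ((\<lambda>p. \<alpha> p v) has_derivative (\<lambda>u. \<alpha>' p u v)) (at p)"
    and cont: "\<And>u v. continuous_on UNIV (\<lambda>p. \<alpha>' p u v)"
    and decay: "\<And>v. exp_decay c (\<lambda>p. \<alpha> p v)" "\<And>u v. exp_decay c (\<lambda>p. \<alpha>' p u v)" "c > 0"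
    and supp: "\<And>p v. norm (snd p) > R \<Longrightarrow> \<alpha> p v = 0"
    and rays: "\<And>x \<omega>. norm \<omega> = 1 \<Longrightarrow> (\<integral>s. \<alpha> (s, x + s *\<^sub>R \<omega>) (1, \<omega>) \<partial>lborel) = 0"
  shows "\<alpha>' p u v = \<alpha>' p v u"
proof -
  have cont0: "continuous_on UNIV (\<lambda>p. \<alpha> p v)" for v
    using has_derivative_continuous[OF d] by (simp add: continuous_at_imp_continuous_on)
  have supp': "\<alpha>' p u v = 0" if "norm (snd p) > R" for p u v
  proof -
    have "open {p :: real \<times> 'a. norm (snd p) > R}" by (intro open_Collect_less continuous_intros)
    then have "((\<lambda>p. \<alpha> p v) has_derivative (\<lambda>_. 0)) (at p)"
      by (rule has_derivative_transform_within_open[OF has_derivative_const]) (use that supp in auto)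
    from fun_cong[OF has_derivative_unique[OF d this]] show ?thesis .
  qed
  have dv: "((\<lambda>s. \<alpha> (p + s *\<^sub>R u) v) has_vector_derivative \<alpha>' p u v) (at 0)" for p u v
  proof -
    have "((\<lambda>s. p + s *\<^sub>R u) has_derivative (\<lambda>s. s *\<^sub>R u)) (at 0)"
      by (auto intro!: derivative_eq_intros)
    from has_derivative_compose[OF this, of "\<lambda>p. \<alpha> p v"] d[of v p]
    have "((\<lambda>s. \<alpha> (p + s *\<^sub>R u) v) has_derivative (\<lambda>s. \<alpha>' p (s *\<^sub>R u) v)) (at 0)" by simp
    moreover have "\<alpha>' p (s *\<^sub>R u) v = s *\<^sub>R \<alpha>' p u v" for s
      by (rule linear_scale[OF has_derivative_linear[OF d]])
    ultimately show ?thesis by (simp add: has_vector_derivative_def)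
  qed
  define L where "L \<zeta> v = (\<integral>p. iexp (\<zeta> \<bullet> p) * \<alpha> p v \<partial>lborel)" for \<zeta> v
  have int: "integrable lborel (\<lambda>p. iexp (\<zeta> \<bullet> p) * f p)"
    if "continuous_on UNIV f" "exp_decay c f" "\<And>p. norm (snd p) > R \<Longrightarrow> f p = 0" for \<zeta> f
    by (rule integrable_if_exp_decay[OF _ exp_decay_iexp_mult[OF that(2)] decay(3), where R = R])
      (auto simp: that intro!: continuous_intros that(1))
  have iL: "integrable lborel (\<lambda>p. iexp (\<zeta> \<bullet> p) * \<alpha> p v)" for \<zeta> v
    by (rule int[OF cont0 decay(1) supp])
  have iL': "integrable lborel (\<lambda>p. iexp (\<zeta> \<bullet> p) * \<alpha>' p u v)" for \<zeta> u v
    by (rule int[OF cont decay(2) supp'])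
  have linL: "linear (L \<zeta>)" for \<zeta>
  proof (rule linearI)
    show "L \<zeta> (v + w) = L \<zeta> v + L \<zeta> w" for v w
      using iL by (simp add: L_def linear_add[OF lin] distrib_left)
    have "L \<zeta> (r *\<^sub>R v) = (\<integral>p. r *\<^sub>R (iexp (\<zeta> \<bullet> p) * \<alpha> p v) \<partial>lborel)" for r v
      by (simp add: L_def linear_scale[OF lin])
    then show "L \<zeta> (r *\<^sub>R v) = r *\<^sub>R L \<zeta> v" for r v
      by (simp add: L_def)
  qed
  have orthL: "L \<zeta> w = 0" if "\<bar>fst \<zeta>\<bar> < norm (snd \<zeta>)" "\<zeta> \<bullet> w = 0" for \<zeta> w
  proof (rule linear_form_eq_0_on_orthogonal[OF linL dim _ that])
    fix \<omega> :: 'a assume "norm \<omega> = 1" "\<zeta> \<bullet> (1, \<omega>) = 0"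
    then show "L \<zeta> (1, \<omega>) = 0"
      unfolding L_def
      by (intro fourier_light_ray_slice[OF cont0 decay(1) decay(3) supp rays]) auto
  qed
  have "\<alpha>' p u v - \<alpha>' p v u = 0"
  proof (rule eq_0_if_fourier_eq_0_spacelike[where g = "\<lambda>p. \<alpha>' p u v - \<alpha>' p v u" and R = R])
    show "continuous_on UNIV (\<lambda>p. \<alpha>' p u v - \<alpha>' p v u)" by (intro continuous_intros cont)
    show "exp_decay c (\<lambda>p. \<alpha>' p u v - \<alpha>' p v u)"
      using exp_decay_add[OF decay(2) exp_decay_mult_left[OF decay(2), of "-1"], of u v v u] by simp
    fix \<zeta> :: "real \<times> 'a" assume \<zeta>: "\<bar>fst \<zeta>\<bar> < norm (snd \<zeta>)"
    have F: "(\<integral>p. iexp (\<zeta> \<bullet> p) * \<alpha>' p u v \<partial>lborel) = - \<i> * of_real (\<zeta> \<bullet> u) * L \<zeta> v" for u v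
      unfolding L_def
      by (rule fourier_directional_derivative[OF dv cont0 cont decay supp supp'])
    have "(\<zeta> \<bullet> u) *\<^sub>R L \<zeta> v - (\<zeta> \<bullet> v) *\<^sub>R L \<zeta> u = L \<zeta> ((\<zeta> \<bullet> u) *\<^sub>R v - (\<zeta> \<bullet> v) *\<^sub>R u)"
      by (simp add: linear_diff[OF linL] linear_scale[OF linL])
    also have "\<dots> = 0" by (rule orthL[OF \<zeta>]) (simp add: inner_diff_right)
    finally have "of_real (\<zeta> \<bullet> u) * L \<zeta> v = of_real (\<zeta> \<bullet> v) * L \<zeta> u" by (simp add: scaleR_conv_of_real)
    then show "(\<integral>p. iexp (\<zeta> \<bullet> p) * (\<alpha>' p u v - \<alpha>' p v u) \<partial>lborel) = 0"
      using iL' by (simp add: right_diff_distrib F)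
  qed (use supp' decay(3) in auto)
  then show ?thesis by simp
qed

section \<open>Potentials of closed forms\<close>

text \<open>Differentiating the integrand in direction \<open>h\<close> gives \<open>\<alpha>(y) h + s
\<alpha>'(y) h (p - q)\<close> at \<open>y = q + s (p - q)\<close>. Closedness swaps the last two arguments,
and the result is the derivative of \<open>s \<alpha>(y) h\<close> with respect to \<open>s\<close>.\<close>

lemma poincare_lemma:
  fixes \<alpha> :: "'a::euclidean_space \<Rightarrow> 'a \<Rightarrow> 'b::banach"
  assumes lin: "\<And>p. linear (\<alpha> p)"
    and d: "\<And>p v. ((\<lambda>p. \<alpha> p v) has_derivative (\<lambda>u. \<alpha>' p u v)) (at p)"
    and cont: "\<And>u v. continuous_on UNIV (\<lambda>p. \<alpha>' p u v)"
    and closed: "\<And>p u v. \<alpha>' p u v = \<alpha>' p v u"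
  shows "((\<lambda>p. integral {0..1} (\<lambda>s. \<alpha> (q + s *\<^sub>R (p - q)) (p - q))) has_derivative \<alpha> p) (at p)"
proof -
  have cont0: "continuous_on UNIV (\<lambda>p. \<alpha> p v)" for v
    using has_derivative_continuous[OF d] by (simp add: continuous_at_imp_continuous_on)
  have lin1: "linear (\<lambda>u. \<alpha>' p u v)" for p v by (rule has_derivative_linear[OF d])
  have exp0: "\<alpha> p v = (\<Sum>b\<in>Basis. (v \<bullet> b) *\<^sub>R \<alpha> p b)" for p v
  proof -
    have "\<alpha> p v = \<alpha> p (\<Sum>b\<in>Basis. (v \<bullet> b) *\<^sub>R b)" by (simp only: euclidean_representation)
    then show ?thesis by (simp only: linear_sum[OF lin] linear_scale[OF lin])
  qed
  have exp1: "\<alpha>' p u v = (\<Sum>b\<in>Basis. (u \<bullet> b) *\<^sub>R \<alpha>' p b v)" for p u v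
  proof -
    have "\<alpha>' p u v = \<alpha>' p (\<Sum>b\<in>Basis. (u \<bullet> b) *\<^sub>R b) v" by (simp only: euclidean_representation)
    then show ?thesis by (simp only: linear_sum[OF lin1] linear_scale[OF lin1])
  qed
  define y where "y p s = q + s *\<^sub>R (p - q)" for p and s :: real
  define D where "D p s h = \<alpha> (y p s) h + s *\<^sub>R \<alpha>' (y p s) h (p - q)" for p s h
  have der: "((\<lambda>p. \<alpha> (y p s) (p - q)) has_derivative D p s) (at p within S)" for p s S
  proof -
    have dy: "((\<lambda>p. y p s) has_derivative (\<lambda>h. s *\<^sub>R h)) (at p within S)"
      unfolding y_def by (auto intro!: derivative_eq_intros)
    have db: "((\<lambda>p. \<alpha> (y p s) b) has_derivative (\<lambda>h. s *\<^sub>R \<alpha>' (y p s) h b)) (at p within S)" for b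
      using has_derivative_compose[OF dy d[of b "y p s"]] linear_scale[OF lin1] by simp
    have "((\<lambda>p. \<Sum>b\<in>Basis. ((p - q) \<bullet> b) *\<^sub>R \<alpha> (y p s) b) has_derivative
        (\<lambda>h. \<Sum>b\<in>Basis. ((p - q) \<bullet> b) *\<^sub>R (s *\<^sub>R \<alpha>' (y p s) h b) + (h \<bullet> b) *\<^sub>R \<alpha> (y p s) b)) (at p within S)"
      by (intro has_derivative_sum has_derivative_scaleR db) (auto intro!: derivative_eq_intros)
    moreover have "(\<Sum>b\<in>Basis. ((p - q) \<bullet> b) *\<^sub>R (s *\<^sub>R \<alpha>' (y p s) h b) + (h \<bullet> b) *\<^sub>R \<alpha> (y p s) b) = D p s h" for h
    proof -
      have "\<alpha>' (y p s) h (p - q) = (\<Sum>b\<in>Basis. ((p - q) \<bullet> b) *\<^sub>R \<alpha>' (y p s) h b)"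
        using exp1[of "y p s" "p - q" h] closed by simp
      then show ?thesis
        unfolding D_def exp0[of "y p s" h]
        by (simp add: sum.distrib scaleR_sum_right mult.commute add.commute)
    qed
    ultimately show ?thesis by (simp add: exp0[symmetric])
  qed
  have bl: "bounded_linear (D p s)" for p s by (rule has_derivative_bounded_linear[OF der])
  have cy: "continuous_on X (\<lambda>(p, s). y p s)" for X unfolding y_def by (auto intro!: continuous_intros simp: case_prod_beta')
  have cD: "continuous_on X (\<lambda>(p, s). D p s h)" for X h
  proof -
    have "D p s h = \<alpha> (y p s) h + s *\<^sub>R (\<Sum>b\<in>Basis. ((p - q) \<bullet> b) *\<^sub>R \<alpha>' (y p s) b h)" for p s
      using exp1[of "y p s" "p - q" h] closed by (simp add: D_def)
    moreover have comp: "continuous_on X (\<lambda>x. f (y (fst x) (snd x)))" if "continuous_on UNIV f" for f :: "'a \<Rightarrow> 'b"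
      by (rule continuous_on_compose2[OF that]) (use cy in \<open>auto simp: case_prod_beta'\<close>)
    ultimately show ?thesis
      by (simp add: case_prod_beta') (intro continuous_intros comp[OF cont] comp[OF cont0])
  qed
  define fx where "fx p s = Blinfun (D p s)" for p s
  have fx: "blinfun_apply (fx p s) = D p s" for p s unfolding fx_def by (rule bounded_linear_Blinfun_apply[OF bl])
  have cfx: "continuous_on X (\<lambda>(p, s). fx p s)" for X
    unfolding case_prod_beta'
    by (rule continuous_on_blinfun_componentwise) (use cD in \<open>simp add: fx case_prod_beta'\<close>)
  have main: "((\<lambda>p. integral (cbox 0 1) (\<lambda>s. \<alpha> (y p s) (p - q))) has_derivative integral (cbox 0 1) (fx p)) (at p within UNIV)"
  proof (rule leibniz_rule)
    show "((\<lambda>p. \<alpha> (y p s) (p - q)) has_derivative blinfun_apply (fx p s)) (at p within UNIV)" for p s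
      unfolding fx by (rule der)
    have "continuous_on (cbox 0 1) (\<lambda>s. \<alpha> (y p s) (p - q))" for p
      by (rule continuous_on_compose2[OF cont0[of "p - q"]]) (auto simp: y_def intro!: continuous_intros)
    then show "(\<lambda>s. \<alpha> (y p s) (p - q)) integrable_on cbox 0 1" for p by (rule integrable_continuous)
    show "continuous_on (UNIV \<times> cbox 0 1) (\<lambda>(p, s). fx p s)" by (rule cfx)
  qed auto
  have "blinfun_apply (integral (cbox 0 1) (fx p)) = \<alpha> p"
  proof
    fix h
    have "continuous_on (cbox 0 1) (fx p)"
      by (rule continuous_on_compose2[OF cfx[of UNIV], where f = "\<lambda>s. (p, s)", simplified])
        (auto intro!: continuous_intros)
    then have "blinfun_apply (integral (cbox 0 1) (fx p)) h = integral (cbox 0 1) (\<lambda>s. D p s h)"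
      using blinfun_apply_integral[OF integrable_continuous, of 0 1 "fx p" h] by (simp add: fx)
    also have "\<dots> = \<alpha> p h"
    proof (rule integral_unique)
      have "((\<lambda>s. D p s h) has_integral 1 *\<^sub>R \<alpha> (y p 1) h - 0 *\<^sub>R \<alpha> (y p 0) h) {0..1}"
      proof (rule fundamental_theorem_of_calculus)
        fix s :: real
        have dys: "((\<lambda>s. y p s) has_derivative (\<lambda>r. r *\<^sub>R (p - q))) (at s within {0..1})"
          unfolding y_def by (auto intro!: derivative_eq_intros)
        have "((\<lambda>s. \<alpha> (y p s) h) has_vector_derivative \<alpha>' (y p s) (p - q) h) (at s within {0..1})"
          unfolding has_vector_derivative_def
          using has_derivative_compose[OF dys d[of h "y p s"]] linear_scale[OF lin1] by simp
        then have "((\<lambda>s. s *\<^sub>R \<alpha> (y p s) h) has_vector_derivative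
            s *\<^sub>R \<alpha>' (y p s) (p - q) h + 1 *\<^sub>R \<alpha> (y p s) h) (at s within {0..1})"
          by (intro has_vector_derivative_scaleR) (auto intro!: derivative_eq_intros)
        then show "((\<lambda>s. s *\<^sub>R \<alpha> (y p s) h) has_vector_derivative D p s h) (at s within {0..1})"
          by (simp add: D_def closed[of _ h] add.commute)
      qed simp
      then show "((\<lambda>s. D p s h) has_integral \<alpha> p h) (cbox 0 1)" by (simp add: y_def)
    qed
    finally show "blinfun_apply (integral (cbox 0 1) (fx p)) h = \<alpha> p h" .
  qed
  then show ?thesis using main by (simp add: y_def)
qed

section \<open>Coordinate derivatives\<close>

lemma has_vector_derivative_frechet_derivative:
  assumes "f differentiable (at p)"
  shows "((\<lambda>s. f (p + s *\<^sub>R v)) has_vector_derivative frechet_derivative f (at p) v) (at 0)"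
proof -
  have f: "(f has_derivative frechet_derivative f (at p)) (at p)"
    using assms frechet_derivative_works by blast
  have "((\<lambda>s. p + s *\<^sub>R v) has_derivative (\<lambda>s. s *\<^sub>R v)) (at 0)"
    by (auto intro!: derivative_eq_intros)
  from has_derivative_compose[OF this, of f] f
  have "((\<lambda>s. f (p + s *\<^sub>R v)) has_derivative (\<lambda>s. frechet_derivative f (at p) (s *\<^sub>R v))) (at 0)" by simp
  then show ?thesis
    by (simp add: has_vector_derivative_def linear_scale[OF has_derivative_linear[OF f]])
qed

lemma dt_eq_frechet_derivative:
  assumes "f differentiable (at p)"
  shows "dt f p = frechet_derivative f (at p) (1, 0)"
proof -
  obtain t x where p: "p = (t, x)" by (cases p)
  have "((\<lambda>s. f (p + s *\<^sub>R (1, 0))) has_vector_derivative frechet_derivative f (at p) (1, 0)) (at (t - t))"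
    using has_vector_derivative_frechet_derivative[OF assms, of "(1, 0)"] by simp
  then have "((\<lambda>s. f (s, x)) has_vector_derivative frechet_derivative f (at p) (1, 0)) (at t)"
    unfolding has_vector_derivative_def has_derivative_at by (simp add: p)
  then show ?thesis by (simp add: dt_def p vector_derivative_at)
qed

lemma dx_eq_frechet_derivative:
  assumes "f differentiable (at p)"
  shows "dx j f p = frechet_derivative f (at p) (0, axis j 1)"
proof -
  obtain t x where p: "p = (t, x)" by (cases p)
  show ?thesis
    using has_vector_derivative_frechet_derivative[OF assms, of "(0, axis j 1)"]
    by (simp add: dx_def p vector_derivative_at)
qed

lemma smooth_dt:
  assumes "smooth f"
  shows "smooth (dt f)"
proof -
  have "dt f = (\<lambda>p. frechet_derivative f (at p) (1, 0))"
    using dt_eq_frechet_derivative[OF smooth_differentiable[OF assms]] by blast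
  then show ?thesis using smooth_frechet_derivative[OF assms] by simp
qed

lemma smooth_dx:
  assumes "smooth f"
  shows "smooth (dx j f)"
proof -
  have "dx j f = (\<lambda>p. frechet_derivative f (at p) (0, axis j 1))"
    using dx_eq_frechet_derivative[OF smooth_differentiable[OF assms]] by blast
  then show ?thesis using smooth_frechet_derivative[OF assms] by simp
qed

lemma frechet_derivative_expand:
  fixes f :: "real \<times> (real ^ 'n) \<Rightarrow> complex"
  assumes "f differentiable (at p)"
  shows "frechet_derivative f (at p) v = of_real (fst v) * dt f p + (\<Sum>j\<in>UNIV. of_real (snd v $ j) * dx j f p)"
proof -
  let ?D = "frechet_derivative f (at p)"
  have lin: "linear ?D" using assms by (rule linear_frechet_derivative)
  have "v = fst v *\<^sub>R (1, 0) + (\<Sum>j\<in>UNIV. (snd v $ j) *\<^sub>R (0, axis j 1))"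
  proof (rule prod_eqI)
    show "snd v = snd (fst v *\<^sub>R (1, 0) + (\<Sum>j\<in>UNIV. (snd v $ j) *\<^sub>R (0, axis j 1)))"
      by (simp add: snd_sum vec_eq_iff axis_def if_distrib cong: if_cong)
  qed (simp add: fst_sum)
  then have "?D v = ?D (fst v *\<^sub>R (1, 0) + (\<Sum>j\<in>UNIV. (snd v $ j) *\<^sub>R (0, axis j 1)))" by simp
  also have "\<dots> = fst v *\<^sub>R ?D (1, 0) + (\<Sum>j\<in>UNIV. (snd v $ j) *\<^sub>R ?D (0, axis j 1))"
    by (simp only: linear_add[OF lin] linear_scale[OF lin] linear_sum[OF lin])
  finally show ?thesis
    using assms by (simp add: dt_eq_frechet_derivative dx_eq_frechet_derivative scaleR_conv_of_real)
qed

lemma frechet_derivative_eq_0_outside: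
  fixes f :: "real \<times> 'a::euclidean_space \<Rightarrow> 'b::real_normed_vector"
  assumes "\<And>p. norm (snd p) > R \<Longrightarrow> f p = 0" and "norm (snd p) > R"
  shows "frechet_derivative f (at p) v = 0"
proof -
  have "open {p :: real \<times> 'a. norm (snd p) > R}" by (intro open_Collect_less continuous_intros)
  then have "(f has_derivative (\<lambda>_. 0)) (at p)"
    by (rule has_derivative_transform_within_open[OF has_derivative_const]) (use assms in auto)
  from frechet_derivative_at[OF this] show ?thesis by metis
qed

text \<open>A class stable under \<open>dt\<close> and \<open>dx\<close>. The support condition makes
integrals over space converge and turns bounds for large times into global ones.\<close>

definition smooth_tube :: "real \<Rightarrow> (real \<times> (real ^ 'n) \<Rightarrow> complex) \<Rightarrow> bool" where
  "smooth_tube R f \<longleftrightarrow> smooth f \<and> (\<forall>p. norm (snd p) > R \<longrightarrow> f p = 0)"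

lemma smooth_tube_dt: "smooth_tube R f \<Longrightarrow> smooth_tube R (dt f)"
  by (auto simp: smooth_tube_def smooth_dt dt_eq_frechet_derivative smooth_differentiable
      intro!: frechet_derivative_eq_0_outside[of R])

lemma smooth_tube_dx: "smooth_tube R f \<Longrightarrow> smooth_tube R (dx j f)"
  by (auto simp: smooth_tube_def smooth_dx dx_eq_frechet_derivative smooth_differentiable
      intro!: frechet_derivative_eq_0_outside[of R])

lemma smooth_tube_dt_funpow: "smooth_tube R f \<Longrightarrow> smooth_tube R ((dt ^^ k) f)"
  by (induction k) (auto intro: smooth_tube_dt)

lemma smooth_tube_dx_funpow: "smooth_tube R f \<Longrightarrow> smooth_tube R ((dx j ^^ k) f)"
  by (induction k) (auto intro: smooth_tube_dx)

lemma smooth_tube_foldr_dx: "smooth_tube R f \<Longrightarrow> smooth_tube R (foldr (\<lambda>j. dx j ^^ \<beta> j) js f)"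
  by (induction js) (auto intro: smooth_tube_dx_funpow)

text \<open>The remaining part \<open>|t| \<le> t\<^sub>0\<close>, \<open>|x| \<le> R\<close> of the tube is
compact, so \<open>h\<close> is bounded there.\<close>

lemma exp_decay_if_eventually:
  fixes h :: "real \<times> 'a::euclidean_space \<Rightarrow> 'b::real_normed_vector"
  assumes cont: "continuous_on UNIV h" and supp: "\<And>p. norm (snd p) > R \<Longrightarrow> h p = 0"
    and far: "\<And>t x. \<bar>t\<bar> \<ge> t0 \<Longrightarrow> norm (h (t, x)) \<le> C * exp (- c * \<bar>t\<bar>)" and "c \<ge> 0" "C \<ge> 0"
  shows "exp_decay c h"
proof -
  have "compact (h ` ({-t0..t0} \<times> cball 0 R))"
    by (intro compact_continuous_image continuous_on_subset[OF cont] compact_Times) auto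
  then obtain B where B': "\<forall>y \<in> h ` ({-t0..t0} \<times> cball 0 R). norm y \<le> B"
    using compact_imp_bounded bounded_iff by metis
  have B: "norm (h (t, x)) \<le> B" if "\<bar>t\<bar> \<le> t0" "norm x \<le> R" for t x
    using that by (intro B'[rule_format] imageI) auto
  have "norm (h (t, x)) \<le> (C + \<bar>B\<bar> * exp (c * t0)) * exp (- c * \<bar>t\<bar>)" for t x
  proof (cases "\<bar>t\<bar> \<ge> t0")
    case True
    show ?thesis by (rule order_trans[OF far[OF True]]) (simp add: distrib_right)
  next
    case False
    have "norm (h (t, x)) \<le> \<bar>B\<bar> * 1"
      using B[of t x] supp[of "(t, x)"] False by (cases "norm x > R") auto
    also have "\<dots> \<le> \<bar>B\<bar> * exp (c * t0 - c * \<bar>t\<bar>)"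
      using False \<open>c \<ge> 0\<close> by (intro mult_left_mono) (auto simp: mult_left_mono)
    also have "\<dots> = \<bar>B\<bar> * exp (c * t0) * exp (- c * \<bar>t\<bar>)" by (simp add: exp_diff exp_minus field_simps)
    also have "\<dots> \<le> (C + \<bar>B\<bar> * exp (c * t0)) * exp (- c * \<bar>t\<bar>)"
      using \<open>C \<ge> 0\<close> by (intro mult_right_mono) auto
    finally show ?thesis .
  qed
  then show ?thesis unfolding exp_decay_def by blast
qed

lemma
  shows distinct_coords: "distinct (coords :: 'n::finite list)"
    and set_coords: "set (coords :: 'n list) = UNIV"
proof -
  have "\<exists>js :: 'n list. distinct js \<and> set js = UNIV"
    using finite_distinct_list[of "UNIV :: 'n set"] by auto
  then have "distinct (coords :: 'n list) \<and> set (coords :: 'n list) = UNIV"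
    unfolding coords_def by (rule someI_ex)
  then show "distinct (coords :: 'n list)" "set (coords :: 'n list) = UNIV" by auto
qed

lemma foldr_dx_cong: "(\<And>j. j \<in> set js \<Longrightarrow> \<beta> j = \<gamma> j) \<Longrightarrow>
    foldr (\<lambda>j. dx j ^^ \<beta> j) js = foldr (\<lambda>j. dx j ^^ \<gamma> j) js"
  by (induction js) auto

lemma foldr_dx_zero: "(\<And>j. j \<in> set js \<Longrightarrow> \<beta> j = 0) \<Longrightarrow> foldr (\<lambda>j. dx j ^^ \<beta> j) js f = f"
  by (induction js) auto

lemma dx_multi_zero: "dx_multi (\<lambda>_. 0) f = f"
  unfolding dx_multi_def by (rule foldr_dx_zero) simp

text \<open>The derivative that acts first belongs to the last coordinate of the enumeration with a nonzero
exponent. Splitting it off turns a derivative of a potential, with the order of differentiation fixed by the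
enumeration, into a derivative of one component of its gradient, again in that order.\<close>

lemma dx_multi_innermost:
  fixes \<beta> :: "'n::finite \<Rightarrow> nat"
  assumes "\<beta> \<noteq> (\<lambda>_. 0)"
  shows "\<exists>j \<beta>'. \<forall>f. dx_multi \<beta> f = dx_multi \<beta>' (dx j f)"
proof -
  have "\<exists>j\<in>set coords. \<beta> j \<noteq> 0" using assms by (simp add: set_coords fun_eq_iff)
  from split_list_last_prop[OF this] obtain xs j ys where c: "coords = xs @ j # ys" "\<beta> j \<noteq> 0" "\<forall>i\<in>set ys. \<not> \<beta> i \<noteq> 0"
    by blast
  define \<beta>' where "\<beta>' = \<beta>(j := \<beta> j - 1)"
  have nj: "j \<notin> set xs" "j \<notin> set ys" using distinct_coords[where 'n = 'n] by (auto simp: c)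
  have z: "foldr (\<lambda>j. dx j ^^ \<beta> j) ys g = g" "foldr (\<lambda>j. dx j ^^ \<beta>' j) ys g = g" for g
    using c(3) nj by (auto intro!: foldr_dx_zero simp: \<beta>'_def)
  have xs: "foldr (\<lambda>j. dx j ^^ \<beta> j) xs = foldr (\<lambda>j. dx j ^^ \<beta>' j) xs"
    by (rule foldr_dx_cong) (use nj in \<open>auto simp: \<beta>'_def\<close>)
  have "dx_multi \<beta> f = dx_multi \<beta>' (dx j f)" for f
  proof -
    have "(dx j ^^ \<beta> j) f = (dx j ^^ (\<beta> j - 1)) (dx j f)"
      using c(2) by (metis One_nat_def Suc_pred comp_apply funpow_Suc_right neq0_conv)
    moreover have "\<beta>' j = \<beta> j - 1" by (simp add: \<beta>'_def)
    ultimately show ?thesis by (simp add: dx_multi_def c(1) z xs)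
  qed
  then show ?thesis by blast
qed

lemma dx_multi_single:
  fixes j :: "'n::finite"
  shows "dx_multi ((\<lambda>_. 0)(j := 1)) f = dx j f"
proof -
  obtain xs ys where c: "coords = xs @ j # ys" using set_coords by (metis UNIV_I split_list)
  have nj: "j \<notin> set xs" "j \<notin> set ys" using distinct_coords[where 'n = 'n] by (auto simp: c)
  define \<delta> :: "'n \<Rightarrow> nat" where "\<delta> = (\<lambda>_. 0)(j := 1)"
  have z: "foldr (\<lambda>i. dx i ^^ \<delta> i) zs g = g" if "j \<notin> set zs" for zs g
    by (rule foldr_dx_zero) (use that in \<open>auto simp: \<delta>_def\<close>)
  have "dx_multi \<delta> f = (dx j ^^ \<delta> j) f" by (simp add: dx_multi_def c z nj)
  then show ?thesis by (simp add: \<delta>_def)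
qed

text \<open>Induction on the coordinates in the order in which they are differentiated. At each coordinate,
its successive powers applied to what the earlier coordinates produced are again of the form
\<open>dx_multi\<close>, so they are bounded and \<open>exp_decay_derivatives\<close> applies. The loss of an
arbitrarily small amount of rate is absorbed by stating the claim for all \<open>r < a\<close>.\<close>

lemma exp_decay_dx_multi:
  fixes f :: "real \<times> (real ^ 'n::finite) \<Rightarrow> complex"
  assumes f: "smooth_tube R f" and "a > 0"
    and bounded: "\<And>\<beta>. exp_decay 0 (dx_multi \<beta> f)"
    and f0: "\<And>r. r < a \<Longrightarrow> exp_decay r f" and r: "r < a"
  shows "exp_decay r (dx_multi \<beta> f)"
proof -
  have "\<forall>r<a. exp_decay r (foldr (\<lambda>j. dx j ^^ \<beta> j) js f)"
    if "coords = pre @ js" for js pre \<beta>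
    using that
  proof (induction js arbitrary: pre \<beta>)
    case Nil
    then show ?case using f0 by simp
  next
    case (Cons j js)
    define g where "g = foldr (\<lambda>j. dx j ^^ \<beta> j) js f"
    have nj: "j \<notin> set pre" "j \<notin> set js" using distinct_coords[where 'n = 'n] by (auto simp: Cons.prems)
    have g: "smooth_tube R g" unfolding g_def by (rule smooth_tube_foldr_dx[OF f])
    have "exp_decay r ((dx j ^^ \<beta> j) g)" if "r < a" for r
    proof (rule exp_decay_derivatives[where h = "\<lambda>k. (dx j ^^ k) g" and v = "(0, axis j 1)" and a = a])
      fix k p
      have "smooth ((dx j ^^ k) g)" using smooth_tube_dx_funpow[OF g] by (simp add: smooth_tube_def)
      then have d: "(dx j ^^ k) g differentiable (at p)" by (rule smooth_differentiable)
      show "((\<lambda>s. (dx j ^^ k) g (p + s *\<^sub>R (0, axis j 1))) has_vector_derivative (dx j ^^ Suc k) g p) (at 0)"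
        using has_vector_derivative_frechet_derivative[OF d, of "(0, axis j 1)"]
        by (simp add: dx_eq_frechet_derivative[OF d])
    next
      fix k
      \<comment> \<open>The multi-index that differentiates \<open>k\<close> times in \<open>x\<^sub>j\<close> after the derivatives already
      applied, and not at all in the coordinates still to come.\<close>
      define \<gamma> where "\<gamma> i = (if i = j then k else if i \<in> set js then \<beta> i else 0)" for i
      have "foldr (\<lambda>j. dx j ^^ \<gamma> j) js = foldr (\<lambda>j. dx j ^^ \<beta> j) js"
        by (rule foldr_dx_cong) (use nj in \<open>auto simp: \<gamma>_def\<close>)
      moreover have "foldr (\<lambda>j. dx j ^^ \<gamma> j) pre h = h" for h
        by (rule foldr_dx_zero) (use nj distinct_coords[where 'n = 'n] in \<open>auto simp: \<gamma>_def Cons.prems\<close>)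
      ultimately have "dx_multi \<gamma> f = (dx j ^^ k) g"
        by (simp add: dx_multi_def Cons.prems g_def) (simp add: \<gamma>_def)
      then show "exp_decay 0 ((dx j ^^ k) g)" using bounded[of \<gamma>] by simp
    next
      fix r assume "r < a"
      then show "exp_decay r ((dx j ^^ 0) g)"
        using Cons.IH[of "pre @ [j]" \<beta>] Cons.prems by (simp add: g_def)
    qed (use \<open>a > 0\<close> \<open>r < a\<close> in auto)
    then show ?case by (simp add: g_def)
  qed
  from this[of "[]" coords \<beta>] show ?thesis using r by (simp add: dx_multi_def)
qed

lemma exp_decay_all_derivatives:
  fixes f :: "real \<times> (real ^ 'n::finite) \<Rightarrow> complex"
  assumes f: "smooth_tube R f" and "a > 0"
    and bounded: "\<And>k \<beta>. exp_decay 0 ((dt ^^ k) (dx_multi \<beta> f))"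
    and f0: "exp_decay a f" and r: "r < a"
  shows "exp_decay r ((dt ^^ k) (dx_multi \<beta> f))"
proof (rule exp_decay_derivatives[where h = "\<lambda>k. (dt ^^ k) (dx_multi \<beta> f)" and v = "(1, 0)" and a = a])
  fix k p
  have "smooth_tube R (dx_multi \<beta> f)" unfolding dx_multi_def by (rule smooth_tube_foldr_dx[OF f])
  then have "smooth ((dt ^^ k) (dx_multi \<beta> f))"
    using smooth_tube_dt_funpow by (auto simp: smooth_tube_def)
  then have d: "(dt ^^ k) (dx_multi \<beta> f) differentiable (at p)" by (rule smooth_differentiable)
  show "((\<lambda>s. (dt ^^ k) (dx_multi \<beta> f) (p + s *\<^sub>R (1, 0))) has_vector_derivative
      (dt ^^ Suc k) (dx_multi \<beta> f) p) (at 0)"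
    using has_vector_derivative_frechet_derivative[OF d, of "(1, 0)"]
    by (simp add: dt_eq_frechet_derivative[OF d])
next
  fix r assume "r < a"
  have fs: "exp_decay s f" if "s < a" for s using exp_decay_mono[OF f0] that by simp
  have b0: "exp_decay 0 (dx_multi \<beta> f)" for \<beta> using bounded[of 0 \<beta>] by simp
  have "exp_decay r (dx_multi \<beta> f)"
    by (rule exp_decay_dx_multi[OF f \<open>a > 0\<close> b0 fs \<open>r < a\<close>])
  then show "exp_decay r ((dt ^^ 0) (dx_multi \<beta> f))" by simp
qed (use assms in auto)

lemma exp_decay_sum:
  fixes f :: "'i \<Rightarrow> real \<times> 'a \<Rightarrow> complex"
  shows "finite I \<Longrightarrow> (\<And>i. i \<in> I \<Longrightarrow> exp_decay c (f i)) \<Longrightarrow> exp_decay c (\<lambda>p. \<Sum>i\<in>I. f i p)"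
proof (induction I rule: finite_induct)
  case empty
  show ?case by (rule exp_decayI[of _ 0]) simp
next
  case (insert i I)
  then show ?case by (simp add: exp_decay_add)
qed

text \<open>The potential is locally constant outside the tube, and in dimension at least 2 the exterior of a
ball is connected.\<close>

lemma potential_eq_0_outside:
  fixes \<phi> :: "real \<times> 'a::euclidean_space \<Rightarrow> complex"
  assumes dim: "DIM('a) \<ge> 2" and d: "\<And>p. (\<phi> has_derivative \<alpha> p) (at p)"
    and supp: "\<And>p v. norm (snd p) > R \<Longrightarrow> \<alpha> p v = 0"
    and q: "norm (snd q) > R" "\<phi> q = 0" and p: "norm (snd p) > R"
  shows "\<phi> p = 0"
proof -
  let ?S = "(UNIV :: real set) \<times> (- cball 0 R :: 'a set)"
  have "connected ?S"
    using dim by (intro connected_Times connected_complement_bounded_convex) auto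
  moreover have "open ?S" by (intro open_Times) auto
  moreover have "continuous_on ?S \<phi>"
    using has_derivative_continuous[OF d] by (simp add: continuous_at_imp_continuous_on)
  moreover have "\<forall>p\<in>?S - {}. (\<phi> has_derivative (\<lambda>_. 0)) (at p within ?S)"
  proof
    fix p assume "p \<in> ?S - {}"
    then have "norm (snd p) > R" by auto
    then have "\<alpha> p = (\<lambda>_. 0)" using supp by blast
    then show "(\<phi> has_derivative (\<lambda>_. 0)) (at p within ?S)" using d[of p] by (metis has_derivative_at_withinI)
  qed
  ultimately have "\<phi> constant_on ?S"
    by (intro has_derivative_zero_connected_constant_on[of ?S "{}"]) auto
  moreover have "q \<in> ?S" "p \<in> ?S" using p q by (auto simp: mem_Times_iff)
  ultimately show ?thesis using q(2) unfolding constant_on_def by metis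
qed

text \<open>From a point of the tube, a segment of length \<open>2 R + 1\<close> in a spatial direction leads
outside it, where \<open>\<phi>\<close> vanishes. Time is constant on the segment, so integrating
\<open>\<alpha>\<close> along it preserves the rate.\<close>

lemma exp_decay_potential:
  fixes \<phi> :: "real \<times> 'a::euclidean_space \<Rightarrow> complex"
  assumes d: "\<And>p. (\<phi> has_derivative \<alpha> p) (at p)"
    and decay: "\<And>v. exp_decay c (\<lambda>p. \<alpha> p v)"
    and supp: "\<And>p. norm (snd p) > R \<Longrightarrow> \<phi> p = 0" and "R > 0"
  shows "exp_decay c \<phi>"
proof -
  obtain b :: 'a where b: "norm b = 1" using nonempty_Basis norm_Basis by blast
  obtain C where C: "C > 0" "\<And>p. norm (\<alpha> p (0, b)) \<le> C * exp (- c * \<bar>fst p\<bar>)"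
    using exp_decayD[OF decay[of "(0, b)"]] by blast
  have "norm (\<phi> p) \<le> (C * (2 * R + 1)) * exp (- c * \<bar>fst p\<bar>)" for p
  proof (cases "norm (snd p) > R")
    case False
    have "norm (\<phi> (p + (2 * R + 1) *\<^sub>R (0, b)) - \<phi> (p + 0 *\<^sub>R (0, b))) \<le> C * exp (- c * \<bar>fst p\<bar>) * (2 * R + 1)"
    proof (rule norm_diff_le_vector_derivative_bound[where \<epsilon> = "2 * R + 1"])
      fix s :: real
      have "((\<lambda>s. p + s *\<^sub>R (0, b)) has_derivative (\<lambda>s. s *\<^sub>R (0, b))) (at s)"
        by (auto intro!: derivative_eq_intros)
      from has_derivative_compose[OF this d]
      show "((\<lambda>s. \<phi> (p + s *\<^sub>R (0, b))) has_vector_derivative \<alpha> (p + s *\<^sub>R (0, b)) (0, b)) (at s)"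
        by (simp add: has_vector_derivative_def linear_scale[OF has_derivative_linear[OF d], symmetric])
      show "norm (\<alpha> (p + s *\<^sub>R (0, b)) (0, b)) \<le> C * exp (- c * \<bar>fst p\<bar>)"
        using C(2)[of "p + s *\<^sub>R (0, b)"] by simp
    qed (use \<open>R > 0\<close> in auto)
    moreover have "\<phi> (p + (2 * R + 1) *\<^sub>R (0, b)) = 0"
    proof (rule supp)
      have "norm ((2 * R + 1) *\<^sub>R b) = 2 * R + 1" using b \<open>R > 0\<close> by simp
      then show "norm (snd (p + (2 * R + 1) *\<^sub>R (0, b))) > R"
        using False norm_diff_ineq[of "(2 * R + 1) *\<^sub>R b" "snd p"] by (simp add: add.commute)
    qed
    ultimately show ?thesis by (simp add: mult.commute mult.left_commute zero_prod_def[symmetric])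
  qed (use C(1) \<open>R > 0\<close> supp in auto)
  then show ?thesis by (rule exp_decayI)
qed

section \<open>The potential of a form with vanishing light ray transform\<close>

theorem theorem6p1:
  fixes A0 :: "real \<times> (real ^ 'n::finite) \<Rightarrow> complex"
    and A :: "'n \<Rightarrow> real \<times> (real ^ 'n) \<Rightarrow> complex"
    and t0 R :: real
  assumes "CARD('n) \<ge> 2" and "t0 > 0" and "R > 0"
    and "\<forall>f \<in> insert A0 (range A). smooth f"
    and "\<forall>(\<alpha>::nat) (\<beta>::'n \<Rightarrow> nat). \<forall>f \<in> insert A0 (range A). \<exists>c>0. \<exists>C>0. \<forall>t x.
           \<bar>t\<bar> \<ge> t0 \<longrightarrow> norm ((dt ^^ \<alpha>) (dx_multi \<beta> f) (t, x)) \<le> C * exp (- c * \<bar>t\<bar>)"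
    and "\<forall>f \<in> insert A0 (range A). \<forall>t x. norm x \<ge> R \<longrightarrow> f (t, x) = 0"
    and "\<forall>t x. \<forall>\<omega> \<in> sphere 0 1.
           (\<integral>s. A0 (t + s, x + s *\<^sub>R \<omega>)
                + (\<Sum>j\<in>UNIV. complex_of_real (\<omega> $ j) * A j (t + s, x + s *\<^sub>R \<omega>)) \<partial>lborel) = 0"
  shows "\<exists>(\<phi> :: real \<times> (real ^ 'n) \<Rightarrow> complex) (C' :: nat \<Rightarrow> ('n \<Rightarrow> nat) \<Rightarrow> real) (c' :: real).
           smooth \<phi> \<and> (\<forall>\<alpha> \<beta>. C' \<alpha> \<beta> > 0) \<and> c' > 0 \<and>
           A0 = dt \<phi> \<and> (\<forall>j. A j = dx j \<phi>) \<and>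
           closure {p. \<phi> p \<noteq> 0} \<subseteq> UNIV \<times> cball 0 R \<and>
           (\<forall>\<alpha> \<beta> t x. norm ((dt ^^ \<alpha>) (dx_multi \<beta> \<phi>) (t, x)) \<le> C' \<alpha> \<beta> * exp (- c' * \<bar>t\<bar>))"
proof -
  let ?F = "insert A0 (range A)"
  have tube: "smooth_tube R f" if "f \<in> ?F" for f
    using assms(4,6) that by (auto simp: smooth_tube_def)
  have ex_rate: "\<exists>c>0. exp_decay c ((dt ^^ k) (dx_multi \<beta> f))" if f: "f \<in> ?F" for k \<beta> f
  proof -
    obtain c C where cC: "c > 0" "C > 0"
      "\<And>t x. \<bar>t\<bar> \<ge> t0 \<Longrightarrow> norm ((dt ^^ k) (dx_multi \<beta> f) (t, x)) \<le> C * exp (- c * \<bar>t\<bar>)"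
      using assms(5) f by blast
    have h: "smooth_tube R ((dt ^^ k) (dx_multi \<beta> f))"
      unfolding dx_multi_def by (intro smooth_tube_dt_funpow smooth_tube_foldr_dx tube f)
    have "exp_decay c ((dt ^^ k) (dx_multi \<beta> f))"
      by (rule exp_decay_if_eventually[where R = R and C = C and ?t0.0 = t0])
        (use h cC in \<open>auto simp: smooth_tube_def smooth_continuous\<close>)
    then show ?thesis using cC(1) by blast
  qed
  have "\<forall>f\<in>?F. \<exists>c>0. exp_decay c f"
    using ex_rate[of _ 0 "\<lambda>_. 0"] by (simp add: dx_multi_zero)
  then obtain rate where rate: "\<And>f. f \<in> ?F \<Longrightarrow> rate f > 0 \<and> exp_decay (rate f) f"
    by metis
  define c0 where "c0 = Min (rate ` ?F)"
  have finF: "finite ?F" by simp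
  have c0: "c0 > 0" unfolding c0_def using rate finF by (subst Min_gr_iff) auto
  have c0F: "exp_decay c0 f" if "f \<in> ?F" for f
  proof (rule exp_decay_mono)
    show "exp_decay (rate f) f" using rate[OF that] by simp
    show "c0 \<le> rate f" unfolding c0_def using finF that by (intro Min_le) auto
  qed
  \<comment> \<open>Any rate strictly below the common rate of the undifferentiated components is inherited by
    all derivatives.\<close>
  define c where "c = c0 / 2"
  have c: "c > 0" "c < c0" using c0 by (auto simp: c_def)
  have decayF: "exp_decay c ((dt ^^ k) (dx_multi \<beta> f))" if f: "f \<in> ?F" for k \<beta> f
  proof (rule exp_decay_all_derivatives[OF tube[OF f] c0 _ c0F[OF f] c(2)])
    show "exp_decay 0 ((dt ^^ k) (dx_multi \<beta> f))" for k \<beta>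
      using ex_rate[OF f, of k \<beta>] exp_decay_mono by (meson less_imp_le)
  qed
  have decay_frechet: "exp_decay c (\<lambda>p. frechet_derivative f (at p) u)" if f: "f \<in> ?F" for f u
  proof -
    have "exp_decay c (dt f)" using decayF[OF f, of 1 "\<lambda>_. 0"] by (simp add: dx_multi_zero)
    moreover have "exp_decay c (dx j f)" for j
      using decayF[OF f, of 0 "(\<lambda>_. 0)(j := 1)"] by (simp only: dx_multi_single funpow_0)
    moreover have "smooth f" using tube[OF f] by (simp add: smooth_tube_def)
    then have "frechet_derivative f (at p) u = of_real (fst u) * dt f p + (\<Sum>j\<in>UNIV. of_real (snd u $ j) * dx j f p)" for p
      by (rule frechet_derivative_expand[OF smooth_differentiable])
    ultimately show ?thesis
      by (simp only:) (intro exp_decay_add exp_decay_mult_left exp_decay_sum; simp)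
  qed
  have decay0: "exp_decay c f" if "f \<in> ?F" for f
    using decayF[OF that, of 0 "\<lambda>_. 0"] by (simp add: dx_multi_zero)
  have inF: "A0 \<in> ?F" "A j \<in> ?F" for j by auto
  define \<alpha> where "\<alpha> p v = of_real (fst v) * A0 p + (\<Sum>j\<in>UNIV. of_real (snd v $ j) * A j p)"
    for p and v :: "real \<times> (real ^ 'n)"
  define \<alpha>' where "\<alpha>' p u v = of_real (fst v) * frechet_derivative A0 (at p) u
      + (\<Sum>j\<in>UNIV. of_real (snd v $ j) * frechet_derivative (A j) (at p) u)"
    for p and u v :: "real \<times> (real ^ 'n)"
  have sm: "smooth f" if "f \<in> ?F" for f using tube[OF that] by (simp add: smooth_tube_def)
  have hd: "(f has_derivative frechet_derivative f (at p)) (at p)" if "f \<in> ?F" for f p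
    by (rule smooth_has_derivative[OF sm[OF that]])
  have d: "((\<lambda>p. \<alpha> p v) has_derivative (\<lambda>u. \<alpha>' p u v)) (at p)" for p v
    unfolding \<alpha>_def \<alpha>'_def
    by (intro has_derivative_add has_derivative_sum has_derivative_mult_right hd inF)
  have lin: "linear (\<alpha> p)" for p
    by (rule linearI)
      (simp_all add: \<alpha>_def distrib_right distrib_left sum.distrib sum_distrib_left
        scaleR_conv_of_real[where 'a = complex] mult.assoc)
  have smooth_\<alpha>: "smooth (\<lambda>p. \<alpha> p v)" for v
    unfolding \<alpha>_def
    by (intro smooth_add smooth_sum smooth_bounded_linear[OF bounded_linear_mult_right] sm inF finite)
  have cont': "continuous_on UNIV (\<lambda>p. \<alpha>' p u v)" for u v
    unfolding \<alpha>'_def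
    by (intro continuous_intros smooth_continuous smooth_frechet_derivative sm inF)
  have supp: "\<alpha> p v = 0" if "norm (snd p) > R" for p v
  proof -
    have z: "f p = 0" if "f \<in> ?F" for f
      using tube[OF that] \<open>norm (snd p) > R\<close> by (cases p) (simp add: smooth_tube_def)
    show ?thesis unfolding \<alpha>_def by (simp only: z[OF inF(1)] z[OF inF(2)]) simp
  qed
  have decay_\<alpha>: "exp_decay c (\<lambda>p. \<alpha> p v)" for v
    unfolding \<alpha>_def by (intro exp_decay_add exp_decay_mult_left exp_decay_sum decay0 inF finite)
  have decay_\<alpha>': "exp_decay c (\<lambda>p. \<alpha>' p u v)" for u v
    unfolding \<alpha>'_def by (intro exp_decay_add exp_decay_mult_left exp_decay_sum decay_frechet inF finite)
  have dim: "DIM(real ^ 'n) \<ge> 2" using assms(1) by simp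
  have closed: "\<alpha>' p u v = \<alpha>' p v u" for p u v
  proof (rule closed_if_light_ray_transform_eq_0[OF dim lin d cont' decay_\<alpha> decay_\<alpha>' c(1) supp])
    fix x \<omega> :: "real ^ 'n" assume "norm \<omega> = 1"
    then have "\<omega> \<in> sphere 0 1" by simp
    from assms(7)[rule_format, OF this, of 0 x]
    show "(\<integral>s. \<alpha> (s, x + s *\<^sub>R \<omega>) (1, \<omega>) \<partial>lborel) = 0" by (simp add: \<alpha>_def)
  qed
  obtain b :: "real ^ 'n" where b: "norm b = 1" using nonempty_Basis norm_Basis by blast
  \<comment> \<open>The base point lies outside the tube, where the potential is to vanish.\<close>
  define q where "q = (0::real, (R + 1) *\<^sub>R b)"
  define \<phi> where "\<phi> p = integral {0..1} (\<lambda>s. \<alpha> (q + s *\<^sub>R (p - q)) (p - q))" for p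
  have d\<phi>: "(\<phi> has_derivative \<alpha> p) (at p)" for p
    unfolding \<phi>_def by (rule poincare_lemma[OF lin d cont' closed])
  have smooth_\<phi>: "smooth \<phi>" by (rule smooth_if_derivative_smooth[OF d\<phi> smooth_\<alpha>])
  have fr: "frechet_derivative \<phi> (at p) = \<alpha> p" for p using frechet_derivative_at[OF d\<phi>] by simp
  have dt\<phi>: "dt \<phi> = A0"
    by (rule ext) (simp add: dt_eq_frechet_derivative smooth_differentiable[OF smooth_\<phi>] fr \<alpha>_def)
  have dx\<phi>: "dx j \<phi> = A j" for j
    by (rule ext) (simp add: dx_eq_frechet_derivative smooth_differentiable[OF smooth_\<phi>] fr \<alpha>_def
        axis_def if_distrib[of of_real] if_distrib[of "\<lambda>z. z * _"] cong: if_cong)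
  have supp\<phi>: "\<phi> p = 0" if "norm (snd p) > R" for p
  proof (rule potential_eq_0_outside[OF dim d\<phi> supp _ _ that])
    show "norm (snd q) > R" using b \<open>R > 0\<close> by (simp add: q_def)
    show "\<phi> q = 0" using linear_0[OF lin] by (simp add: \<phi>_def)
  qed
  have decay\<phi>: "exp_decay c ((dt ^^ k) (dx_multi \<beta> \<phi>))" for k \<beta>
  proof (cases "\<beta> = (\<lambda>_. 0)")
    case True
    show ?thesis
    proof (cases k)
      case 0
      then show ?thesis
        using exp_decay_potential[OF d\<phi> decay_\<alpha> supp\<phi> \<open>R > 0\<close>] True by (simp add: dx_multi_zero)
    next
      case (Suc m)
      have "(dt ^^ k) (dx_multi \<beta> \<phi>) = (dt ^^ m) (dx_multi (\<lambda>_. 0) A0)"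
        by (simp only: Suc True dx_multi_zero funpow_Suc_right comp_apply dt\<phi>)
      then show ?thesis using decayF[OF inF(1)] by simp
    qed
  next
    case False
    then obtain j \<beta>' where "dx_multi \<beta> \<phi> = dx_multi \<beta>' (dx j \<phi>)"
      using dx_multi_innermost by blast
    then show ?thesis using decayF[OF inF(2)] by (simp add: dx\<phi>)
  qed
  have "\<forall>k \<beta>. \<exists>C>0. \<forall>p. norm ((dt ^^ k) (dx_multi \<beta> \<phi>) p) \<le> C * exp (- c * \<bar>fst p\<bar>)"
    by (intro allI exp_decayD decay\<phi>)
  then obtain C' where C': "\<And>k \<beta>. C' k \<beta> > 0"
    "\<And>k \<beta> p. norm ((dt ^^ k) (dx_multi \<beta> \<phi>) p) \<le> C' k \<beta> * exp (- c * \<bar>fst p\<bar>)"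
    by metis
  have "closure {p. \<phi> p \<noteq> 0} \<subseteq> UNIV \<times> cball 0 R"
  proof (rule closure_minimal)
    show "{p. \<phi> p \<noteq> 0} \<subseteq> UNIV \<times> cball 0 R" using supp\<phi> by (force simp: mem_Times_iff)
    show "closed ((UNIV :: real set) \<times> (cball 0 R :: (real ^ 'n) set))" by (intro closed_Times) auto
  qed
  then show ?thesis
    using smooth_\<phi> C' c(1) dt\<phi> dx\<phi> by (intro exI[of _ \<phi>] exI[of _ C'] exI[of _ c]) force
qed

end
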